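(* The set $\mathcal R$ equals the range of the exponential map of $\mathbf{P_{curve}}$: $$\mathcal R=\{Exp(\lambda(0),L)\mid(\lambda(0),L)\in\mathcal D_0\}\subset\mathbb R^3\rtimes S^2,$$ i.e. it coincides with the set of all possible end conditions $(\mathbf x(L),\mathbf x'(L))$ of geodesics of $\mathbf{P_{curve}}$.
   Context: $SE(3)=\mathbb R^3\rtimes SO(3)$ with product $(\mathbf x_1,R_1)(\mathbf x_2,R_2)=(\mathbf x_1+R_1\mathbf x_2,R_1R_2)$, $e=(\mathbf 0,I)$; action on $\mathbb R^3\rtimes S^2:=SE(3)/(\{\mathbf 0\}\times SO(2))$ by $(\mathbf x,R)\odot(\mathbf y,\mathbf n)=(R\mathbf y+\mathbf x,R\mathbf n)$ ($SO(2)$ = rotations about $\mathbf e_z$). For $\mathbf a\in\mathbb R^3$, $\sigma_{\mathbf a}\mathbf y=\mathbf a\times\mathbf y$. Left-invariant frame $\mathcal A_i|_{(\mathbf x,R)}=(R\mathbf e_i,0)$, $\mathcal A_{3+i}|_{(\mathbf x,R)}=(0,R\sigma_{\mathbf e_i})$, $i=1,2,3$, dual coframe $\omega^i$. Fix $\xi>0$. Problem $\mathbf{P_{MEC}}$: minimize sub-Riemannian length with respect to $\mathcal G_\xi=\xi^2\omega^3\otimes\omega^3+\omega^4\otimes\omega^4+\omega^5\otimes\omega^5$ over horizontal curves ($\dot\gamma\in\Delta=\mathrm{span}\{\mathcal A_3,\mathcal A_4,\mathcal A_5\}$) in $SE(3)$ from $e$ to a given end point. Its geodesics in sub-Riemannian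 arclength $t$ are projections of solutions of the Hamiltonian system with $H(\lambda)=\frac12(\xi^{-2}\lambda_3^2+\lambda_4^2+\lambda_5^2)=\frac12$: $\dot\gamma=\xi^{-2}\lambda_3\mathcal A_3+\lambda_4\mathcal A_4+\lambda_5\mathcal A_5$; $\dot\lambda_1=-\lambda_3\lambda_5$, $\dot\lambda_2=\lambda_3\lambda_4$, $\dot\lambda_3=\lambda_1\lambda_5-\lambda_2\lambda_4$, $\dot\lambda_4=\xi^{-2}\lambda_2\lambda_3-\lambda_5\lambda_6$, $\dot\lambda_5=\lambda_4\lambda_6-\xi^{-2}\lambda_1\lambda_3$, $\dot\lambda_6=0$. $\widetilde{Exp}_e(\lambda(0),t)\in SE(3)$ denotes the end point at time $t$ of the geodesic from $e$ with initial momentum $\lambda(0)$, $H(\lambda(0))=\frac12$. $\mathcal R=\{(\mathbf x_1,R_1\mathbf e_z)\mid(\mathbf x_1,R_1)\in\mathfrak R\}$, where $\mathfrak R$ is the set of end points $(\mathbf x_1,R_1)\in SE(3)$ reachable from $e$ by geodesics $\gamma^*:[0,T]\to SE(3)$ of $\mathbf{P_{MEC}}$ satisfying $u^3(t)=\langle\omega^3,\dot\gamma^*(t)\rangle>0$ for all $t\in(0,T)$ and $\lambda_6\equiv0$. $\mathbf{P_{curve}}$: minimize $\int_0^L\sqrt{\xi^2+\kappa^2(s)}\,ds$ over arclength-parametrized curves in $\mathbb R^3$ ($L$ free) with $\mathbf x(0)=\mathbf 0$, $\mathbf x'(0)=\mathbf e_z$ and prescribed $\mathbf x(L),\mathbf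 x'(L)$. Its exponential map is $Exp(\lambda(0),L)=\widetilde{Exp}_e(\lambda(0),T(L))\odot(\mathbf 0,\mathbf e_z)=(\mathbf x^*(L),\frac{d}{ds}\mathbf x^*(L))$, where $\mathbf x^*$ is the spatial projection of the geodesic, parametrized by spatial arclength, and $T(L)$ is the sub-Riemannian arclength corresponding to spatial length $L$; its domain is $\mathcal D_0=\{(\lambda(0),L)\in T_e^*(SE(3))\times\mathbb R^+\mid\lambda_6(0)=0,\ H(\lambda(0))=\frac12,\ L\le s_{max}(\lambda(0)),\ (\lambda_1,\lambda_2,\lambda_3)(0)\ne\mathbf 0\}$, where $s_{max}(\lambda(0))\in\mathbb R\cup\{\infty\}$ is the maximal length of the spatial projection of the geodesic up to its first cusp (first positive time where $u^3$ vanishes).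
   Formalization: The domain D_0 also carries the boundary condition x*'(0)=e_z of P_curve; without it, momenta starting backwards, e.g. λ(0)=(0,0,-ξ,0,0,0), give end points such as ((0,0,-L),e_z) that are not in R. *)

theory Defs
  imports "HOL-Analysis.Analysis"
begin

section \<open>The group \<open>SE(3)\<close> and its left-invariant frame\<close>

text \<open>A pair \<open>(x, R)\<close> of a translation and a matrix. Tangent vectors at \<open>(x, R)\<close> are represented
  in the ambient vector space by pairs of the same type.\<close>

type_synonym se3 = "(real^3) \<times> (real^3^3)"

definition SE3 :: "se3 set" where
  "SE3 = {(x, R). rotation_matrix R}"

definition se3_one :: se3 where
  "se3_one = (0, mat 1)"

abbreviation e_z :: "real^3" where
  "e_z \<equiv> axis 3 1"

text \<open>The homogeneous space \<open>\<real>\<^sup>3 \<rtimes> S\<^sup>2\<close>: the coset of \<open>(y, R)\<close> modulo the rotations about \<open>e_z\<close> is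
  identified with \<open>(y, R e_z)\<close>, a point of \<open>\<real>\<^sup>3 \<times> S\<^sup>2\<close>.\<close>

definition R3S2 :: "((real^3) \<times> (real^3)) set" where
  "R3S2 = UNIV \<times> sphere 0 1"

definition se3_act :: "se3 \<Rightarrow> (real^3) \<times> (real^3) \<Rightarrow> (real^3) \<times> (real^3)" where
  "se3_act g p = (snd g *v fst p + fst g, snd g *v snd p)"

definition sigma :: "real^3 \<Rightarrow> real^3^3" where
  "sigma a = matrix (cross3 a)"

text \<open>The frame \<open>A\<^sub>1, \<dots>, A\<^sub>6\<close>: \<open>frame_trans i\<close> is \<open>A\<^sub>i\<close> and \<open>frame_rot i\<close> is \<open>A\<close> with index
  \<open>3 + i\<close>, for \<open>i\<close> in \<open>{1, 2, 3}\<close>.\<close>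

definition frame_trans :: "3 \<Rightarrow> se3 \<Rightarrow> se3" where
  "frame_trans i g = (snd g *v axis i 1, 0)"

definition frame_rot :: "3 \<Rightarrow> se3 \<Rightarrow> se3" where
  "frame_rot i g = (0, snd g ** sigma (axis i 1))"

text \<open>Coordinates of a tangent vector in the frame, i.e. the values of the dual coframe on it.\<close>

definition coframe :: "se3 \<Rightarrow> se3 \<Rightarrow> (real^3) \<times> (real^3)" where
  "coframe g v = (THE c. v = (\<Sum>i\<in>UNIV. (fst c $ i) *\<^sub>R frame_trans i g)
                           + (\<Sum>i\<in>UNIV. (snd c $ i) *\<^sub>R frame_rot i g))"

definition omega3 :: "se3 \<Rightarrow> se3 \<Rightarrow> real" where
  "omega3 g v = fst (coframe g v) $ 3"

definition u3 :: "(real \<Rightarrow> se3) \<Rightarrow> real \<Rightarrow> real" where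
  "u3 \<gamma> t = omega3 (\<gamma> t) (vector_derivative \<gamma> (at t))"


section \<open>Sub-Riemannian geodesics\<close>

text \<open>A covector is given by its components \<open>\<lambda>\<^sub>1, \<dots>, \<lambda>\<^sub>6\<close> in the dual coframe. Note that the
  numeral 6 in the index type 6 denotes the same element as 0.\<close>

definition hamiltonian :: "real \<Rightarrow> real^6 \<Rightarrow> real" where
  "hamiltonian \<xi> l = ((l$3)\<^sup>2 / \<xi>\<^sup>2 + (l$4)\<^sup>2 + (l$5)\<^sup>2) / 2"

definition hamiltonian_solution ::
  "real \<Rightarrow> real set \<Rightarrow> (real \<Rightarrow> se3) \<Rightarrow> (real \<Rightarrow> real^6) \<Rightarrow> bool" where
  "hamiltonian_solution \<xi> I \<gamma> l \<longleftrightarrow> (\<forall>t\<in>I.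
     \<gamma> t \<in> SE3 \<and> hamiltonian \<xi> (l t) = 1/2 \<and>
     (\<gamma> has_vector_derivative
        (l t $ 3 / \<xi>\<^sup>2) *\<^sub>R frame_trans 3 (\<gamma> t) + (l t $ 4) *\<^sub>R frame_rot 1 (\<gamma> t)
          + (l t $ 5) *\<^sub>R frame_rot 2 (\<gamma> t)) (at t within I) \<and>
     ((\<lambda>\<tau>. l \<tau> $ 1) has_real_derivative - (l t $ 3 * l t $ 5)) (at t within I) \<and>
     ((\<lambda>\<tau>. l \<tau> $ 2) has_real_derivative l t $ 3 * l t $ 4) (at t within I) \<and>
     ((\<lambda>\<tau>. l \<tau> $ 3) has_real_derivative
        l t $ 1 * l t $ 5 - l t $ 2 * l t $ 4) (at t within I) \<and>
     ((\<lambda>\<tau>. l \<tau> $ 4) has_real_derivative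
        l t $ 2 * l t $ 3 / \<xi>\<^sup>2 - l t $ 5 * l t $ 6) (at t within I) \<and>
     ((\<lambda>\<tau>. l \<tau> $ 5) has_real_derivative
        l t $ 4 * l t $ 6 - l t $ 1 * l t $ 3 / \<xi>\<^sup>2) (at t within I) \<and>
     ((\<lambda>\<tau>. l \<tau> $ 6) has_real_derivative 0) (at t within I))"

text \<open>A geodesic of \<open>P\<^sub>M\<^sub>E\<^sub>C\<close> from the identity, in sub-Riemannian arclength on \<open>[0, T]\<close>, together
  with its momentum.\<close>

definition PMEC_geodesic ::
  "real \<Rightarrow> real \<Rightarrow> (real \<Rightarrow> se3) \<Rightarrow> (real \<Rightarrow> real^6) \<Rightarrow> bool" where
  "PMEC_geodesic \<xi> T \<gamma> l \<longleftrightarrow> hamiltonian_solution \<xi> {0..T} \<gamma> l \<and> \<gamma> 0 = se3_one"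

text \<open>The end point at time \<open>t \<ge> 0\<close> of the geodesic with initial momentum \<open>l0\<close>. It is meaningful
  if \<open>hamiltonian \<xi> l0 = 1/2\<close>: the Hamiltonian is a constant of motion and the solution exists for
  all times and is unique.\<close>

definition Exp_SE3 :: "real \<Rightarrow> real^6 \<Rightarrow> real \<Rightarrow> se3" where
  "Exp_SE3 \<xi> l0 t = (THE g. \<exists>\<gamma> l. PMEC_geodesic \<xi> t \<gamma> l \<and> l 0 = l0 \<and> \<gamma> t = g)"

definition frak_R :: "real \<Rightarrow> se3 set" where
  "frak_R \<xi> = {g. \<exists>T \<gamma> l. 0 < T \<and> PMEC_geodesic \<xi> T \<gamma> l \<and>
                  (\<forall>t\<in>{0<..<T}. u3 \<gamma> t > 0) \<and> (\<forall>t\<in>{0..T}. l t $ 6 = 0) \<and> g = \<gamma> T}"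

definition cal_R :: "real \<Rightarrow> ((real^3) \<times> (real^3)) set" where
  "cal_R \<xi> = {(fst g, snd g *v e_z) | g. g \<in> frak_R \<xi>}"


section \<open>Spatial arclength and cusps\<close>

definition cusp_time :: "real \<Rightarrow> real^6 \<Rightarrow> ereal" where
  "cusp_time \<xi> l0 = Inf {ereal t | t. 0 < t \<and> u3 (Exp_SE3 \<xi> l0) t = 0}"

definition spatial_length :: "real \<Rightarrow> real^6 \<Rightarrow> real \<Rightarrow> real" where
  "spatial_length \<xi> l0 t =
     integral {0..t} (\<lambda>\<tau>. norm (vector_derivative (\<lambda>\<rho>. fst (Exp_SE3 \<xi> l0 \<rho>)) (at \<tau>)))"

definition s_max :: "real \<Rightarrow> real^6 \<Rightarrow> ereal" where
  "s_max \<xi> l0 = Sup {ereal (spatial_length \<xi> l0 t) | t. 0 \<le> t \<and> ereal t \<le> cusp_time \<xi> l0}"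

text \<open>The sub-Riemannian arclength \<open>T(L)\<close> that corresponds to the spatial length \<open>L\<close>.\<close>

definition sr_time :: "real \<Rightarrow> real^6 \<Rightarrow> real \<Rightarrow> real" where
  "sr_time \<xi> l0 L =
     (THE t. 0 \<le> t \<and> ereal t \<le> cusp_time \<xi> l0 \<and> spatial_length \<xi> l0 t = L)"

definition x_star :: "real \<Rightarrow> real^6 \<Rightarrow> real \<Rightarrow> real^3" where
  "x_star \<xi> l0 s = fst (Exp_SE3 \<xi> l0 (sr_time \<xi> l0 s))"


section \<open>The exponential map of \<open>P\<^sub>c\<^sub>u\<^sub>r\<^sub>v\<^sub>e\<close>\<close>

definition Exp_curve :: "real \<Rightarrow> real^6 \<Rightarrow> real \<Rightarrow> (real^3) \<times> (real^3)" where
  "Exp_curve \<xi> l0 L = se3_act (Exp_SE3 \<xi> l0 (sr_time \<xi> l0 L)) (0, e_z)"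

text \<open>The last condition is the boundary condition \<open>x'(0) = e_z\<close> of \<open>P\<^sub>c\<^sub>u\<^sub>r\<^sub>v\<^sub>e\<close>. It excludes initial
  momenta for which the geodesic starts moving backwards, with \<open>u\<^sup>3 < 0\<close>: their spatial projections
  start in direction \<open>- e_z\<close> and are not admissible for \<open>P\<^sub>c\<^sub>u\<^sub>r\<^sub>v\<^sub>e\<close>. The other condition
  \<open>x(0) = 0\<close> holds for every geodesic from the identity.\<close>

definition D0 :: "real \<Rightarrow> ((real^6) \<times> real) set" where
  "D0 \<xi> = {(l0, L). 0 < L \<and> l0 $ 6 = 0 \<and> hamiltonian \<xi> l0 = 1/2 \<and> ereal L \<le> s_max \<xi> l0 \<and>
            (l0 $ 1, l0 $ 2, l0 $ 3) \<noteq> (0, 0, 0) \<and>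
            (x_star \<xi> l0 has_vector_derivative e_z) (at 0 within {0..L})}"

definition Pcurve_geodesic :: "real \<Rightarrow> real \<Rightarrow> (real \<Rightarrow> real^3) \<Rightarrow> bool" where
  "Pcurve_geodesic \<xi> L x \<longleftrightarrow> (\<exists>l0. (l0, L) \<in> D0 \<xi> \<and> (\<forall>s\<in>{0..L}. x s = x_star \<xi> l0 s))"

end

theory Submission
  imports Defs
begin

text \<open>Both sets consist of the points \<open>(x(T), R(T) e\<^sub>z)\<close> of geodesics with \<open>\<lambda>\<^sub>6 = 0\<close> and \<open>\<lambda>\<^sub>3 > 0\<close> on
  \<open>(0, T)\<close>. Passing to the spatial arclength \<open>\<sigma>\<close> costs nothing at a cusp: since
  \<open>dx = R e\<^sub>z d\<sigma>\<close>, the curve has tangent \<open>R e\<^sub>z\<close> at every point of the closed interval, also where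
  \<open>\<lambda>\<^sub>3\<close> vanishes; at \<open>0\<close> this tangent detects the sign of \<open>\<lambda>\<^sub>3\<close>. It remains to see that every
  \<open>L \<le> s_max\<close> is attained. This can fail only if there is no cusp, and then
  \<open>\<lambda>\<^sub>3'' = -\<lambda>\<^sub>3 (\<lambda>\<^sub>4\<^sup>2 + \<lambda>\<^sub>5\<^sup>2 + (\<lambda>\<^sub>1\<^sup>2 + \<lambda>\<^sub>2\<^sup>2) / \<xi>\<^sup>2)\<close> makes \<open>|\<lambda>\<^sub>3|\<close> concave, hence nondecreasing, so the
  spatial length is unbounded.

  The exponential map is given by a description operator, so existence and uniqueness of
  geodesics are needed as well. Global existence holds because the vector field is quadratic
  in \<open>(R, \<lambda>)\<close> and its first integrals bound \<open>(R, \<lambda>)\<close>.\<close>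

section \<open>Ordinary differential equations\<close>

lemma at_within_atLeast_eq_atLeastAtMost:
  fixes t T :: real
  assumes "0 \<le> t" "t < T"
  shows "at t within {0..} = at t within {0..T}"
  by (rule at_within_nhd[of _ "{..<T}"]) (use assms in auto)

lemma has_vector_derivative_zero_imp_eq:
  fixes f :: "real \<Rightarrow> 'a::real_normed_vector"
  assumes "\<And>t. t \<in> {a..b} \<Longrightarrow> (f has_vector_derivative 0) (at t within {a..b})" "t \<in> {a..b}"
  shows "f t = f a"
proof -
  obtain c where "\<And>x. x \<in> {a..b} \<Longrightarrow> f x = c"
    using has_vector_derivative_zero_constant[of "{a..b}" f] assms(1) by auto
  with assms(2) show ?thesis by simp
qed

text \<open>Picard iteration. Measured against the weight \<open>exp (2 * K * t)\<close>,
  consecutive differences shrink by a factor 1/2 per step on every interval \<open>{0..T}\<close>;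
  this replaces the gluing of short-time solutions.\<close>

lemma picard_lindelof_global:
  fixes f :: "'a::banach \<Rightarrow> 'a"
  assumes "L-lipschitz_on UNIV f"
  obtains x where "x 0 = x0"
    "\<And>t. 0 \<le> t \<Longrightarrow> (x has_vector_derivative f (x t)) (at t within {0..})"
proof -
  \<comment> \<open>Strictly positive even if \<open>L\<close> is 0, since the bound below divides
    by \<open>K\<close>.\<close>
  define K where "K = L + 1"
  have K: "K > 0" using lipschitz_on_nonneg[OF assms] by (simp add: K_def)
  have lip: "norm (f a - f b) \<le> K * norm (a - b)" for a b
    using lipschitz_on_normD[OF lipschitz_on_mono[OF assms subset_UNIV, of K UNIV], of a b]
    by (simp add: K_def)
  have fcont: "uniformly_continuous_on UNIV f"
    using lipschitz_on_uniformly_continuous[OF assms] .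
  define P where "P = rec_nat (\<lambda>t::real. x0) (\<lambda>_ y t. x0 + integral {0..t} (\<lambda>s. f (y s)))"
  have P0: "P 0 t = x0" and PS: "P (Suc n) t = x0 + integral {0..t} (\<lambda>s. f (P n s))" for n t
    by (simp_all add: P_def)
  have cont: "continuous_on {0..T} (P n)" for n T
  proof (induction n)
    case 0
    then show ?case by (simp add: P0)
  next
    case (Suc n)
    have "(\<lambda>s. f (P n s)) integrable_on {0..T}"
      using continuous_on_compose2[OF uniformly_continuous_imp_continuous[OF fcont] Suc]
      by (auto intro: integrable_continuous_real)
    then show ?case
      unfolding PS by (intro continuous_intros indefinite_integral_continuous_1)
  qed
  have fPcont: "continuous_on {0..T} (\<lambda>s. f (P n s))" for n T
    by (intro continuous_on_compose2[OF uniformly_continuous_imp_continuous[OF fcont] cont]) auto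
  have derP: "(P (Suc n) has_vector_derivative f (P n t)) (at t within {0..T})"
    if "t \<in> {0..T}" for n t T
    unfolding PS using that
    by (auto intro!: derivative_eq_intros integral_has_vector_derivative fPcont)
  define D where "D n t = P (Suc n) t - P n t" for n t
  define C where "C = norm (f x0)"
  \<comment> \<open>Chosen so that \<open>\<phi> (Suc n)\<close> has derivative
    \<open>K * \<phi> n\<close>, which dominates the derivative of \<open>D (Suc n)\<close> by the
    Lipschitz bound and the induction hypothesis.\<close>
  define \<phi> where "\<phi> n t = C / K * exp (2 * K * t) * (1/2)^n" for n t
  have Dbound: "norm (D n t) \<le> \<phi> n t" if "0 \<le> t" for n t
    using that
  proof (induction n arbitrary: t)
    case 0
    show ?case
    proof (cases "t = 0")
      case True
      then show ?thesis using K by (simp add: D_def P0 PS \<phi>_def C_def)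
    next
      case False
      have "norm (D 0 t - D 0 0) \<le> \<phi> 0 t - \<phi> 0 0"
      proof (rule differentiable_bound_general[where f' = "\<lambda>_. f x0" and \<phi>' = "\<lambda>s. 2 * C * exp (2 * K * s)"])
        show "0 < t" using 0 False by simp
        show "continuous_on {0..t} (D 0)" unfolding D_def by (intro continuous_intros cont)
        show "continuous_on {0..t} (\<phi> 0)" unfolding \<phi>_def by (intro continuous_intros)
        fix s assume s: "0 < s" "s < t"
        show "(D 0 has_vector_derivative f x0) (at s)"
          unfolding D_def P0
          using derP[of s t 0] s at_within_Icc_at[of 0 s t]
          by (auto intro!: derivative_eq_intros simp: P0)
        show "(\<phi> 0 has_vector_derivative 2 * C * exp (2 * K * s)) (at s)"
          unfolding \<phi>_def has_real_derivative_iff_has_vector_derivative[symmetric]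
          using K by (auto intro!: derivative_eq_intros)
        have "C * 1 \<le> C * (2 * exp (2 * K * s))"
        proof (rule mult_left_mono)
          have "exp (2 * K * s) \<ge> 1" using K s by simp
          then show "1 \<le> 2 * exp (2 * K * s)" by linarith
        qed (simp add: C_def)
        then show "norm (f x0) \<le> 2 * C * exp (2 * K * s)" by (simp add: C_def)
      qed
      moreover have "D 0 0 = 0" by (simp add: D_def P0 PS)
      moreover have "\<phi> 0 0 \<ge> 0" using K by (simp add: \<phi>_def C_def)
      ultimately show ?thesis by simp
    qed
  next
    case (Suc n)
    show ?case
    proof (cases "t = 0")
      case True
      then show ?thesis using K by (simp add: D_def PS \<phi>_def C_def)
    next
      case False
      have "norm (D (Suc n) t - D (Suc n) 0) \<le> \<phi> (Suc n) t - \<phi> (Suc n) 0"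
      proof (rule differentiable_bound_general[where f' = "\<lambda>s. f (P (Suc n) s) - f (P n s)" and \<phi>' = "\<lambda>s. K * \<phi> n s"])
        show "0 < t" using Suc.prems False by simp
        show "continuous_on {0..t} (D (Suc n))" unfolding D_def by (intro continuous_intros cont)
        show "continuous_on {0..t} (\<phi> (Suc n))" unfolding \<phi>_def by (intro continuous_intros)
        fix s assume s: "0 < s" "s < t"
        show "(D (Suc n) has_vector_derivative f (P (Suc n) s) - f (P n s)) (at s)"
          unfolding D_def
          using derP[of s t "Suc n"] derP[of s t n] s at_within_Icc_at[of 0 s t]
          by (auto intro!: derivative_eq_intros)
        show "(\<phi> (Suc n) has_vector_derivative K * \<phi> n s) (at s)"
          unfolding \<phi>_def has_real_derivative_iff_has_vector_derivative[symmetric]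
          using K by (auto intro!: derivative_eq_intros)
        have "norm (f (P (Suc n) s) - f (P n s)) \<le> K * norm (D n s)"
          unfolding D_def by (rule lip)
        also have "\<dots> \<le> K * \<phi> n s" using Suc.IH[of s] s K by simp
        finally show "norm (f (P (Suc n) s) - f (P n s)) \<le> K * \<phi> n s" .
      qed
      moreover have "D (Suc n) 0 = 0" by (simp add: D_def PS)
      moreover have "\<phi> (Suc n) 0 \<ge> 0" using K by (simp add: \<phi>_def C_def)
      ultimately show ?thesis by simp
    qed
  qed
  define x where "x t = x0 + (\<Sum>n. D n t)" for t
  have Psum: "P n t = x0 + (\<Sum>i<n. D i t)" for n t
    by (induction n) (auto simp: P0 D_def)
  have ulim: "uniform_limit {0..T} P x sequentially" for T
  proof -
    have "uniform_limit {0..T} (\<lambda>n t. \<Sum>i<n. D i t) (\<lambda>t. \<Sum>i. D i t) sequentially"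
    proof (rule Weierstrass_m_test[where M = "\<lambda>n. C / K * exp (2 * K * T) * (1/2)^n"])
      fix n t assume t: "t \<in> {0..T}"
      then have "norm (D n t) \<le> \<phi> n t" using Dbound by simp
      also have "\<dots> \<le> C / K * exp (2 * K * T) * (1/2)^n"
        unfolding \<phi>_def using t K by (intro mult_mono mult_nonneg_nonneg) (auto simp: C_def)
      finally show "norm (D n t) \<le> C / K * exp (2 * K * T) * (1/2)^n" .
    qed (intro summable_mult summable_geometric, simp)
    then have "uniform_limit {0..T} (\<lambda>n t. x0 + (\<Sum>i<n. D i t)) x sequentially"
      unfolding x_def by (intro uniform_limit_intros)
    then show ?thesis unfolding Psum[symmetric] by simp
  qed
  have xcont: "continuous_on {0..T} x" for T
    by (rule uniform_limit_theorem[OF _ ulim]) (simp_all add: cont)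
  have fxcont: "continuous_on {0..T} (\<lambda>s. f (x s))" for T
    by (intro continuous_on_compose2[OF uniformly_continuous_imp_continuous[OF fcont] xcont]) auto
  have xeq: "x t = x0 + integral {0..t} (\<lambda>s. f (x s))" if "0 \<le> t" for t
  proof -
    \<comment> \<open>Uniform convergence lets the limit pass through \<open>f\<close> and then
      through the integral in the recursion.\<close>
    have ulf: "uniform_limit {0..t} (\<lambda>n s. f (P n s)) (\<lambda>s. f (x s)) sequentially"
      by (rule uniform_limit_compose_uniformly_continuous_on[OF ulim fcont]) auto
    obtain I J where IJ: "\<And>n. ((\<lambda>s. f (P n s)) has_integral I n) {0..t}"
        "((\<lambda>s. f (x s)) has_integral J) {0..t}" "I \<longlonglongrightarrow> J"
      by (rule uniform_limit_integral[OF ulf fPcont sequentially_bot]) (rule that)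
    have "(\<lambda>n. P (Suc n) t) \<longlonglongrightarrow> x0 + J"
      unfolding PS integral_unique[OF IJ(1)] by (intro tendsto_intros IJ(3))
    moreover have "(\<lambda>n. P (Suc n) t) \<longlonglongrightarrow> x t"
      using tendsto_uniform_limitI[OF ulim, of t t] that LIMSEQ_Suc by fastforce
    ultimately show ?thesis
      using LIMSEQ_unique integral_unique[OF IJ(2)] by blast
  qed
  show thesis
  proof
    show "x 0 = x0" using xeq[of 0] by simp
    fix t :: real assume t: "0 \<le> t"
    \<comment> \<open>The interval is prolonged to \<open>t + 1\<close>, so that near
      \<open>t\<close> it coincides with the half-line.\<close>
    have "((\<lambda>u. x0 + integral {0..u} (\<lambda>s. f (x s))) has_vector_derivative f (x t)) (at t within {0..t+1})"
      using t by (auto intro!: derivative_eq_intros integral_has_vector_derivative fxcont)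
    then have "(x has_vector_derivative f (x t)) (at t within {0..t+1})"
      by (rule has_vector_derivative_transform[rotated 2]) (use t xeq in auto)
    then show "(x has_vector_derivative f (x t)) (at t within {0..})"
      using at_within_atLeast_eq_atLeastAtMost[of t "t+1"] t by simp
  qed
qed

text \<open>Gronwall's argument: the squared distance of the two solutions, weighted by
  \<open>exp (- 2 * L * s)\<close>, cannot increase. The Lipschitz bound concerns only a set
  \<open>X\<close> that contains both trajectories, which suits fields that are Lipschitz on bounded
  sets.\<close>

lemma ivp_unique:
  fixes x y :: "real \<Rightarrow> 'a::real_inner"
  assumes lip: "L-lipschitz_on X f"
    and x: "\<And>t. t \<in> {0..T} \<Longrightarrow> (x has_vector_derivative f (x t)) (at t within {0..T})"
    and y: "\<And>t. t \<in> {0..T} \<Longrightarrow> (y has_vector_derivative f (y t)) (at t within {0..T})"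
    and X: "\<And>t. t \<in> {0..T} \<Longrightarrow> x t \<in> X" "\<And>t. t \<in> {0..T} \<Longrightarrow> y t \<in> X"
    and init: "x 0 = y 0" and t: "t \<in> {0..T}"
  shows "x t = y t"
proof (cases "t = 0")
  case False
  define w where "w s = exp (- 2 * L * s) * ((x s - y s) \<bullet> (x s - y s))" for s
  define w' where "w' s = exp (- 2 * L * s) * (2 * ((x s - y s) \<bullet> (f (x s) - f (y s)))
      - 2 * L * ((x s - y s) \<bullet> (x s - y s)))" for s
  have der: "(w has_real_derivative w' s) (at s within {0..T})" if "s \<in> {0..T}" for s
    unfolding w_def w'_def
    using x[OF that, unfolded has_vector_derivative_def] y[OF that, unfolded has_vector_derivative_def]
    unfolding has_field_derivative_def
    by (auto intro!: derivative_eq_intros simp: algebra_simps inner_commute fun_eq_iff)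
  have "w t \<le> w 0"
  proof (rule DERIV_nonpos_imp_decreasing_open[of 0 t])
    show "0 \<le> t" using t by simp
    show "continuous_on {0..t} w"
      using t by (intro DERIV_continuous_on[where D = w'] DERIV_subset[OF der]) auto
    fix s assume s: "0 < s" "s < t"
    have "(x s - y s) \<bullet> (f (x s) - f (y s)) \<le> norm (x s - y s) * norm (f (x s) - f (y s))"
      by (rule norm_cauchy_schwarz)
    also have "\<dots> \<le> norm (x s - y s) * (L * norm (x s - y s))"
      using s t by (intro mult_left_mono lipschitz_on_normD[OF lip] X) auto
    also have "\<dots> = L * ((x s - y s) \<bullet> (x s - y s))"
      by (simp add: power2_norm_eq_inner[symmetric] power2_eq_square)
    finally have "w' s \<le> 0" unfolding w'_def by (simp add: mult_nonneg_nonpos)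
    moreover have "(w has_real_derivative w' s) (at s)"
      using der[of s] s t at_within_Icc_at[of 0 s T] by auto
    ultimately show "\<exists>y. (w has_real_derivative y) (at s) \<and> y \<le> 0" by blast
  qed
  then have "(x t - y t) \<bullet> (x t - y t) \<le> 0" by (simp add: w_def init mult_le_0_iff)
  then show ?thesis by (metis antisym inner_ge_zero inner_eq_zero_iff right_minus_eq)
qed (simp add: init)

section \<open>Truncation of quadratic vector fields outside a ball\<close>

definition radial_retraction :: "real \<Rightarrow> 'a::real_normed_vector \<Rightarrow> 'a" where
  "radial_retraction B y = (B / max B (norm y)) *\<^sub>R y"

lemma radial_retraction_id: "norm y \<le> B \<Longrightarrow> 0 < B \<Longrightarrow> radial_retraction B y = y"
  by (simp add: radial_retraction_def max_def)

lemma norm_radial_retraction_le: "0 < B \<Longrightarrow> norm (radial_retraction B y) \<le> B"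
  by (simp add: radial_retraction_def max_def divide_simps)

text \<open>The difference splits into a change of the point and a change of the scalar factor; each
  contributes at most \<open>norm (x - y)\<close>, hence the constant 2.\<close>

lemma radial_retraction_lipschitz:
  assumes B: "0 < B"
  shows "2-lipschitz_on UNIV (radial_retraction B)"
proof (rule lipschitz_onI)
  fix x y :: 'a
  let ?m = "\<lambda>x. max B (norm x)"
  have pos: "?m x > 0" "?m y > 0" using B by auto
  have "radial_retraction B x - radial_retraction B y
      = (B / ?m x) *\<^sub>R (x - y) + (B / ?m x - B / ?m y) *\<^sub>R y"
    by (simp add: radial_retraction_def algebra_simps)
  then have "norm (radial_retraction B x - radial_retraction B y)
      \<le> norm ((B / ?m x) *\<^sub>R (x - y)) + norm ((B / ?m x - B / ?m y) *\<^sub>R y)"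
    by (metis norm_triangle_ineq)
  also have "norm ((B / ?m x) *\<^sub>R (x - y)) \<le> 1 * norm (x - y)"
    unfolding norm_scaleR using B pos by (intro mult_right_mono) auto
  also have "norm ((B / ?m x - B / ?m y) *\<^sub>R y) \<le> norm (x - y)"
  proof -
    have "\<bar>?m y - ?m x\<bar> \<le> \<bar>norm y - norm x\<bar>" by (auto simp: max_def abs_if)
    also have "\<dots> \<le> norm (x - y)" by (metis norm_minus_commute norm_triangle_ineq3)
    finally have 1: "\<bar>?m y - ?m x\<bar> \<le> norm (x - y)" .
    have "B / ?m x - B / ?m y = (B / ?m x) * ((?m y - ?m x) / ?m y)"
      using pos by (simp add: field_simps)
    then have "norm ((B / ?m x - B / ?m y) *\<^sub>R y) = (B / ?m x) * (norm y / ?m y) * \<bar>?m y - ?m x\<bar>"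
      using pos B by (simp add: abs_mult)
    also have "\<dots> \<le> 1 * norm (x - y)"
      using pos B 1 by (intro mult_mono mult_le_one) auto
    finally show ?thesis by simp
  qed
  finally show "dist (radial_retraction B x) (radial_retraction B y) \<le> 2 * dist x y"
    by (simp add: dist_norm)
qed simp

text \<open>Follows from \<open>b y y - b z z = b (y - z) y + b z (y - z)\<close>, where one
  argument of each term stays in the ball.\<close>

lemma bounded_bilinear_quadratic_lipschitz:
  fixes b :: "'a::real_normed_vector \<Rightarrow> 'a \<Rightarrow> 'b::real_normed_vector"
  assumes "bounded_bilinear b"
  obtains L where "L-lipschitz_on (cball 0 B) (\<lambda>y. b y y)"
proof -
  interpret bounded_bilinear b by fact
  obtain K where K: "0 \<le> K" "\<And>x y. norm (b x y) \<le> norm x * norm y * K"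
    using nonneg_bounded by blast
  have "(2 * \<bar>B\<bar> * K)-lipschitz_on (cball 0 B) (\<lambda>y. b y y)"
  proof (rule lipschitz_onI)
    fix y z :: 'a assume yz: "y \<in> cball 0 B" "z \<in> cball 0 B"
    have "b y y - b z z = b (y - z) y + b z (y - z)"
      by (simp add: diff_left diff_right)
    then have "norm (b y y - b z z) \<le> norm (b (y - z) y) + norm (b z (y - z))"
      by (metis norm_triangle_ineq)
    also have "\<dots> \<le> norm (y - z) * norm y * K + norm z * norm (y - z) * K"
      by (intro add_mono K)
    also have "\<dots> \<le> norm (y - z) * \<bar>B\<bar> * K + \<bar>B\<bar> * norm (y - z) * K"
      using yz K(1) by (intro add_mono mult_right_mono mult_left_mono) auto
    finally show "dist (b y y) (b z z) \<le> 2 * \<bar>B\<bar> * K * dist y z"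
      by (simp add: dist_norm algebra_simps)
  qed (use K in simp)
  then show thesis by (rule that)
qed

text \<open>The retraction multiplies the quadratic field by a scalar factor, so quantities conserved
  along reparametrised solutions, and hence the a priori bound, survive the truncation.\<close>

lemma quadratic_ode_global_solution:
  fixes b :: "'a::banach \<Rightarrow> 'a \<Rightarrow> 'a"
  assumes b: "bounded_bilinear b" and B: "0 < B"
    and bound: "\<And>x c t. x 0 = x0 \<Longrightarrow>
      (\<And>t. 0 \<le> t \<Longrightarrow> (x has_vector_derivative c t *\<^sub>R b (x t) (x t)) (at t within {0..})) \<Longrightarrow>
      0 \<le> t \<Longrightarrow> norm (x t) \<le> B"
  obtains x where "x 0 = x0"
    "\<And>t. 0 \<le> t \<Longrightarrow> (x has_vector_derivative b (x t) (x t)) (at t within {0..})"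
proof -
  interpret bounded_bilinear b by fact
  define f where "f y = b (radial_retraction B y) (radial_retraction B y)" for y
  obtain L where "L-lipschitz_on (cball 0 B) (\<lambda>y. b y y)"
    using bounded_bilinear_quadratic_lipschitz[OF b] by blast
  then have "L-lipschitz_on (range (radial_retraction B :: 'a \<Rightarrow> 'a)) (\<lambda>y. b y y)"
    by (rule lipschitz_on_subset) (use norm_radial_retraction_le[OF B] in auto)
  then have "(L * 2)-lipschitz_on UNIV f"
    unfolding f_def using lipschitz_on_compose2[OF radial_retraction_lipschitz[OF B]] by blast
  then obtain x where x: "x 0 = x0"
      "\<And>t. 0 \<le> t \<Longrightarrow> (x has_vector_derivative f (x t)) (at t within {0..})"
    using picard_lindelof_global by blast
  have "f y = (B / max B (norm y))\<^sup>2 *\<^sub>R b y y" for y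
    by (simp add: f_def radial_retraction_def scaleR_left scaleR_right power2_eq_square)
  with x have "norm (x t) \<le> B" if "0 \<le> t" for t
    using that bound[of x "\<lambda>t. (B / max B (norm (x t)))\<^sup>2"] by auto
  \<comment> \<open>By the a priori bound the trajectory stays where the retraction is the identity,
    so the truncated solution solves the original equation.\<close>
  then have "f (x t) = b (x t) (x t)" if "0 \<le> t" for t
    using that B by (simp add: f_def radial_retraction_id)
  with x that show thesis by metis
qed

section \<open>The Lie--Poisson system\<close>

text \<open>The entries lie in an arbitrary normed space, so that the rule serves both for the
  components of a vector and for the rows of a matrix.\<close>

lemma has_vector_derivative_vec_iff:
  fixes f :: "real \<Rightarrow> 'a::real_normed_vector ^ 'n"
  shows "(f has_vector_derivative f') (at t within S) \<longleftrightarrow>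
    (\<forall>i. ((\<lambda>t. f t $ i) has_vector_derivative f' $ i) (at t within S))"
proof
  assume "(f has_vector_derivative f') (at t within S)"
  then show "\<forall>i. ((\<lambda>t. f t $ i) has_vector_derivative f' $ i) (at t within S)"
    by (intro allI bounded_linear.has_vector_derivative[OF bounded_linear_vec_nth])
next
  assume *: "\<forall>i. ((\<lambda>t. f t $ i) has_vector_derivative f' $ i) (at t within S)"
  have lin: "bounded_linear (axis i :: 'a \<Rightarrow> 'a ^ 'n)" for i
    by (rule bounded_linear_intro[where K = 1])
      (auto simp: axis_def vec_eq_iff norm_vec_def L2_set_def if_distrib[of norm]
        if_distrib[of "\<lambda>z. z\<^sup>2"] cong: if_cong)
  have eq: "y = (\<Sum>i\<in>UNIV. axis i (y $ i))" for y :: "'a ^ 'n"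
    by (simp add: vec_eq_iff axis_def)
  have "((\<lambda>t. \<Sum>i\<in>UNIV. axis i (f t $ i)) has_vector_derivative (\<Sum>i\<in>UNIV. axis i (f' $ i))) (at t within S)"
    by (intro has_vector_derivative_sum bounded_linear.has_vector_derivative[OF lin]) (use * in auto)
  then show "(f has_vector_derivative f') (at t within S)"
    using eq by (metis (no_types, lifting) has_vector_derivative_transform ext)
qed

lemma has_vector_derivative_Pair_iff:
  "(f has_vector_derivative f') (at t within S) \<longleftrightarrow>
    ((\<lambda>t. fst (f t)) has_vector_derivative fst f') (at t within S) \<and>
    ((\<lambda>t. snd (f t)) has_vector_derivative snd f') (at t within S)"
proof
  assume "(f has_vector_derivative f') (at t within S)"
  then show "((\<lambda>t. fst (f t)) has_vector_derivative fst f') (at t within S) \<and>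
    ((\<lambda>t. snd (f t)) has_vector_derivative snd f') (at t within S)"
    by (intro conjI bounded_linear.has_vector_derivative[OF bounded_linear_fst]
        bounded_linear.has_vector_derivative[OF bounded_linear_snd])
next
  assume "((\<lambda>t. fst (f t)) has_vector_derivative fst f') (at t within S) \<and>
    ((\<lambda>t. snd (f t)) has_vector_derivative snd f') (at t within S)"
  then show "(f has_vector_derivative f') (at t within S)"
    using has_derivative_Pair[of "\<lambda>t. fst (f t)" _ t S "\<lambda>t. snd (f t)"]
    unfolding has_vector_derivative_def by (simp add: scaleR_prod_def)
qed

text \<open>The angular velocity in the moving frame: the controls along \<open>A\<^sub>4\<close>
  and \<open>A\<^sub>5\<close> are \<open>\<lambda>\<^sub>4\<close> and
  \<open>\<lambda>\<^sub>5\<close>, and \<open>A\<^sub>6\<close> is not horizontal.\<close>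

definition eta :: "real^3 \<Rightarrow> real^3" where
  "eta q = vector [q$1, q$2, 0]"

text \<open>Acts on triples \<open>(R, p, q)\<close> with \<open>p = (\<lambda>\<^sub>1, \<lambda>\<^sub>2, \<lambda>\<^sub>3)\<close> and \<open>q = (\<lambda>\<^sub>4, \<lambda>\<^sub>5, \<lambda>\<^sub>6)\<close>; on the diagonal it
  is the Hamiltonian vector field without its spatial part, in Lie--Poisson form. The rows of \<open>R\<close>
  obey the same equation as \<open>p\<close>, because \<open>R p\<close> is constant.\<close>

definition lie_poisson :: "real \<Rightarrow> (real^3^3) \<times> (real^3) \<times> (real^3) \<Rightarrow> (real^3^3) \<times> (real^3) \<times> (real^3)
    \<Rightarrow> (real^3^3) \<times> (real^3) \<times> (real^3)" where
  "lie_poisson \<xi> y z =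
    (\<chi> i. cross3 (fst y $ i) (eta (snd (snd z))),
     cross3 (fst (snd y)) (eta (snd (snd z))),
     cross3 (fst (snd y)) (vector [0, 0, fst (snd z) $ 3 / \<xi>\<^sup>2]) + cross3 (snd (snd y)) (eta (snd (snd z))))"

lemma bounded_bilinear_lie_poisson: "bounded_bilinear (lie_poisson \<xi>)"
  unfolding bilinear_conv_bounded_bilinear[symmetric] bilinear_def
  by (auto intro!: linearI simp: lie_poisson_def eta_def cross3_def vec_eq_iff forall_3 vector_3 algebra_simps
      add_divide_distrib)

section \<open>First integrals of the Lie--Poisson field along solutions with a scalar time
  factor\<close>

context
  fixes \<xi> T :: real and c :: "real \<Rightarrow> real" and y :: "real \<Rightarrow> (real^3^3) \<times> (real^3) \<times> (real^3)"
  assumes y: "\<And>t. t \<in> {0..T} \<Longrightarrow>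
    (y has_vector_derivative c t *\<^sub>R lie_poisson \<xi> (y t) (y t)) (at t within {0..T})"
begin

lemma lie_poisson_components:
  assumes t: "t \<in> {0..T}"
  shows "((\<lambda>t. fst (y t) $ i) has_vector_derivative
        c t *\<^sub>R cross3 (fst (y t) $ i) (eta (snd (snd (y t))))) (at t within {0..T})"
    and "((\<lambda>t. fst (snd (y t))) has_vector_derivative
        c t *\<^sub>R cross3 (fst (snd (y t))) (eta (snd (snd (y t))))) (at t within {0..T})"
    and "((\<lambda>t. snd (snd (y t))) has_vector_derivative
        c t *\<^sub>R (cross3 (fst (snd (y t))) (vector [0, 0, fst (snd (y t)) $ 3 / \<xi>\<^sup>2])
          + cross3 (snd (snd (y t))) (eta (snd (snd (y t)))))) (at t within {0..T})"
  using y[OF t] unfolding has_vector_derivative_Pair_iff[of y] has_vector_derivative_Pair_iff[of "\<lambda>t. snd (y t)"]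
    has_vector_derivative_vec_iff[of "\<lambda>t. fst (y t)"]
  by (auto simp: lie_poisson_def)

text \<open>All rows turn with the same angular velocity, and the cross product with a fixed vector
  is skew-symmetric; hence the Gram matrix of the rows is constant.\<close>

lemma lie_poisson_inner_rows:
  assumes "t \<in> {0..T}"
  shows "fst (y t) $ i \<bullet> fst (y t) $ j = fst (y 0) $ i \<bullet> fst (y 0) $ j"
proof (rule has_vector_derivative_zero_imp_eq[OF _ assms])
  fix t assume t: "t \<in> {0..T}"
  show "((\<lambda>t. fst (y t) $ i \<bullet> fst (y t) $ j) has_vector_derivative 0) (at t within {0..T})"
    using has_derivative_inner[OF lie_poisson_components(1)[OF t, of i, unfolded has_vector_derivative_def]
        lie_poisson_components(1)[OF t, of j, unfolded has_vector_derivative_def]]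
    unfolding has_vector_derivative_def
    by (rule has_derivative_eq_rhs) (auto simp: fun_eq_iff cross3_def inner_vec_def sum_3 vector_3 algebra_simps)
qed

text \<open>The derivative of \<open>p\<close> is orthogonal to \<open>p\<close>. The conserved
  \<open>\<lambda>\<^sub>1\<^sup>2 + \<lambda>\<^sub>2\<^sup>2 + \<lambda>\<^sub>3\<^sup>2\<close>
  is a Casimir function.\<close>

lemma lie_poisson_norm:
  assumes "t \<in> {0..T}"
  shows "norm (fst (snd (y t))) = norm (fst (snd (y 0)))"
proof -
  have "fst (snd (y t)) \<bullet> fst (snd (y t)) = fst (snd (y 0)) \<bullet> fst (snd (y 0))"
  proof (rule has_vector_derivative_zero_imp_eq[OF _ assms])
    fix t assume t: "t \<in> {0..T}"
    show "((\<lambda>t. fst (snd (y t)) \<bullet> fst (snd (y t))) has_vector_derivative 0) (at t within {0..T})"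
      using has_derivative_inner[OF lie_poisson_components(2)[OF t, unfolded has_vector_derivative_def]
          lie_poisson_components(2)[OF t, unfolded has_vector_derivative_def]]
      unfolding has_vector_derivative_def
      by (rule has_derivative_eq_rhs) (auto simp: fun_eq_iff dot_cross_self)
  qed
  then show ?thesis by (simp add: norm_eq)
qed

text \<open>The conserved quantity is twice the Hamiltonian; the cubic terms of its derivative
  cancel in pairs.\<close>

lemma lie_poisson_energy:
  assumes "t \<in> {0..T}"
  shows "(fst (snd (y t)) $ 3)\<^sup>2 / \<xi>\<^sup>2 + (snd (snd (y t)) $ 1)\<^sup>2 + (snd (snd (y t)) $ 2)\<^sup>2
    = (fst (snd (y 0)) $ 3)\<^sup>2 / \<xi>\<^sup>2 + (snd (snd (y 0)) $ 1)\<^sup>2 + (snd (snd (y 0)) $ 2)\<^sup>2"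
    (is "?E t = ?E 0")
proof (rule has_vector_derivative_zero_imp_eq[OF _ assms])
  fix t assume t: "t \<in> {0..T}"
  note d2 = lie_poisson_components(2)[OF t, unfolded has_vector_derivative_vec_iff forall_3
      has_real_derivative_iff_has_vector_derivative[symmetric]]
  note d3 = lie_poisson_components(3)[OF t, unfolded has_vector_derivative_vec_iff forall_3
      has_real_derivative_iff_has_vector_derivative[symmetric]]
  show "(?E has_vector_derivative 0) (at t within {0..T})"
    unfolding has_real_derivative_iff_has_vector_derivative[symmetric]
    using d2 d3
    by (auto intro!: derivative_eq_intros simp: eta_def cross3_def vector_3 divide_inverse algebra_simps power2_eq_square)
qed

lemma lie_poisson_q3:
  assumes "t \<in> {0..T}"
  shows "snd (snd (y t)) $ 3 = snd (snd (y 0)) $ 3"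
proof (rule has_vector_derivative_zero_imp_eq[OF _ assms])
  fix t assume t: "t \<in> {0..T}"
  show "((\<lambda>t. snd (snd (y t)) $ 3) has_vector_derivative 0) (at t within {0..T})"
    using lie_poisson_components(3)[OF t, unfolded has_vector_derivative_vec_iff, rule_format, of 3]
    by (simp add: eta_def cross3_def vector_3 mult.commute)
qed

end

text \<open>In the constant 5, the three unit rows of \<open>R\<close> account for 3, and
  \<open>q $ 1\<close> and \<open>q $ 2\<close>, bounded by the energy, for 1 each. The norm of
  \<open>p\<close> and the component \<open>q $ 3\<close> keep their initial values.\<close>

lemma lie_poisson_solution_bound:
  assumes y: "\<And>t. t \<in> {0..T} \<Longrightarrow>
      (y has_vector_derivative c t *\<^sub>R lie_poisson \<xi> (y t) (y t)) (at t within {0..T})"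
    and init: "fst (y 0) = mat 1"
      "(fst (snd (y 0)) $ 3)\<^sup>2 / \<xi>\<^sup>2 + (snd (snd (y 0)) $ 1)\<^sup>2 + (snd (snd (y 0)) $ 2)\<^sup>2 = 1"
    and t: "t \<in> {0..T}"
  shows "norm (y t) \<le> 5 + norm (fst (snd (y 0))) + \<bar>snd (snd (y 0)) $ 3\<bar>"
proof -
  obtain R p q where yt: "y t = (R, p, q)" by (cases "y t") auto
  have R: "norm (R $ i) = 1" for i
    using lie_poisson_inner_rows[OF y t, of i i]
    by (simp add: yt init(1) norm_eq_1 mat_def inner_vec_def if_distrib[of "\<lambda>z. z * _"] cong: if_cong)
  have p: "norm p = norm (fst (snd (y 0)))"
    using lie_poisson_norm[OF y t] by (simp add: yt)
  have E: "(p $ 3)\<^sup>2 / \<xi>\<^sup>2 + (q $ 1)\<^sup>2 + (q $ 2)\<^sup>2 = 1"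
    using lie_poisson_energy[OF y t] init(2) by (simp add: yt)
  moreover have "0 \<le> (p $ 3)\<^sup>2 / \<xi>\<^sup>2" by simp
  ultimately have "(q $ 1)\<^sup>2 \<le> 1" "(q $ 2)\<^sup>2 \<le> 1"
    using zero_le_power2[of "q $ 1"] zero_le_power2[of "q $ 2"] by linarith+
  then have q12: "\<bar>q $ 1\<bar> \<le> 1" "\<bar>q $ 2\<bar> \<le> 1"
    by (simp_all add: abs_square_le_1)
  have "norm (y t) \<le> norm R + (norm p + norm q)"
    unfolding yt by (intro order_trans[OF norm_Pair_le] add_left_mono norm_Pair_le)
  moreover have "norm R \<le> 3"
    using L2_set_le_sum[of UNIV "\<lambda>i. norm (R $ i)"] R by (simp add: norm_vec_def[of R])
  moreover have "norm q \<le> \<bar>q $ 1\<bar> + \<bar>q $ 2\<bar> + \<bar>q $ 3\<bar>"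
    using norm_le_l1_cart[of q] by (simp add: sum_3)
  moreover have "q $ 3 = snd (snd (y 0)) $ 3"
    using lie_poisson_q3[OF y t] by (simp add: yt)
  ultimately show ?thesis using p q12 by simp
qed

lemma lie_poisson_global_solution:
  assumes "(p0 $ 3)\<^sup>2 / \<xi>\<^sup>2 + (q0 $ 1)\<^sup>2 + (q0 $ 2)\<^sup>2 = 1"
  obtains y where "y 0 = (mat 1, p0, q0)"
    "\<And>t. 0 \<le> t \<Longrightarrow> (y has_vector_derivative lie_poisson \<xi> (y t) (y t)) (at t within {0..})"
proof (rule quadratic_ode_global_solution[OF bounded_bilinear_lie_poisson[of \<xi>],
      of "5 + norm p0 + \<bar>q0 $ 3\<bar>" "(mat 1, p0, q0)"])
  show "0 < 5 + norm p0 + \<bar>q0 $ 3\<bar>" using norm_ge_zero[of p0] by linarith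
  fix y c and t :: real
  assume init: "y 0 = (mat 1, p0, q0)" and t: "0 \<le> t"
    and y: "\<And>t. 0 \<le> t \<Longrightarrow> (y has_vector_derivative c t *\<^sub>R lie_poisson \<xi> (y t) (y t)) (at t within {0..})"
  have "norm (y t) \<le> 5 + norm (fst (snd (y 0))) + \<bar>snd (snd (y 0)) $ 3\<bar>"
  proof (rule lie_poisson_solution_bound[where T = t])
    fix s assume "s \<in> {0..t}"
    then show "(y has_vector_derivative c s *\<^sub>R lie_poisson \<xi> (y s) (y s)) (at s within {0..t})"
      using y[of s] by (auto intro: has_vector_derivative_within_subset)
  qed (use init assms t in auto)
  then show "norm (y t) \<le> 5 + norm p0 + \<bar>q0 $ 3\<bar>" by (simp add: init)
qed (use that in blast)

text \<open>Constant inner products keep the rows orthonormal. The determinant is then 1 or -1 at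
  each time, and by continuity it cannot leave its initial value 1.\<close>

lemma lie_poisson_rotation:
  assumes y: "\<And>t. t \<in> {0..T} \<Longrightarrow>
      (y has_vector_derivative c t *\<^sub>R lie_poisson \<xi> (y t) (y t)) (at t within {0..T})"
    and init: "rotation_matrix (fst (y 0))" and t: "t \<in> {0..T}"
  shows "rotation_matrix (fst (y t))"
proof -
  have orth: "orthogonal_matrix (fst (y s))" if "s \<in> {0..T}" for s
    using init lie_poisson_inner_rows[OF y that]
    unfolding rotation_matrix_def orthogonal_matrix_orthonormal_rows
    by (simp add: row_def vec_nth_inverse norm_eq_1 orthogonal_def)
  then have det: "det (fst (y s)) = 1 \<or> det (fst (y s)) = -1" if "s \<in> {0..T}" for s
    using det_orthogonal_matrix that by blast
  have "continuous_on {0..T} y"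
    using y by (intro continuous_on_vector_derivative)
  then have cont: "continuous_on {0..T} (\<lambda>s. det (fst (y s)))"
    unfolding det_3 by (intro continuous_intros)
  have "det (fst (y t)) = 1"
  proof (rule ccontr)
    assume "det (fst (y t)) \<noteq> 1"
    then have "det (fst (y t)) \<le> 0" "0 \<le> det (fst (y 0))"
      using det[OF t] init by (auto simp: rotation_matrix_def)
    then obtain s where "0 \<le> s" "s \<le> t" "det (fst (y s)) = 0"
      using IVT2'[of "\<lambda>s. det (fst (y s))" t 0 0] t continuous_on_subset[OF cont] by auto
    then show False using det[of s] t by auto
  qed
  with orth t show ?thesis by (simp add: rotation_matrix_def)
qed

section \<open>Geodesics\<close>

lemma forall_6: "(\<forall>i::6. P i) \<longleftrightarrow> P 1 \<and> P 2 \<and> P 3 \<and> P 4 \<and> P 5 \<and> P 6"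
proof -
  have "i = 1 \<or> i = 2 \<or> i = 3 \<or> i = 4 \<or> i = 5 \<or> i = 6" for i :: 6
  proof (induct i)
    case (of_int z)
    \<comment> \<open>The residue 0 is the index written \<open>6\<close>.\<close>
    then have "z = 0 \<or> z = 1 \<or> z = 2 \<or> z = 3 \<or> z = 4 \<or> z = 5" by auto
    then show ?case by auto
  qed
  then show ?thesis by metis
qed

text \<open>The position is left out: it does not influence the rotation and the momentum, and is
  recovered from them by integration.\<close>

definition lp_state :: "(real \<Rightarrow> se3) \<Rightarrow> (real \<Rightarrow> real^6) \<Rightarrow> real \<Rightarrow> (real^3^3) \<times> (real^3) \<times> (real^3)" where
  "lp_state \<gamma> l t = (snd (\<gamma> t), vector [l t $ 1, l t $ 2, l t $ 3], vector [l t $ 4, l t $ 5, l t $ 6])"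

definition covector :: "real^3 \<Rightarrow> real^3 \<Rightarrow> real^6" where
  "covector p q = (\<chi> i. if i = 1 then p$1 else if i = 2 then p$2 else if i = 3 then p$3
     else if i = 4 then q$1 else if i = 5 then q$2 else q$3)"

lemma covector_nth [simp]:
  "covector p q $ 1 = p $ 1" "covector p q $ 2 = p $ 2" "covector p q $ 3 = p $ 3"
  "covector p q $ 4 = q $ 1" "covector p q $ 5 = q $ 2" "covector p q $ 6 = q $ 3"
  by (simp_all add: covector_def)

text \<open>Since \<open>v \<bullet> (w \<times> u) = (v \<times> w) \<bullet> u\<close>,
  multiplying \<open>R\<close> by \<open>sigma w\<close> from the right replaces each row
  \<open>v\<close> of \<open>R\<close> by the cross product of \<open>v\<close> with
  \<open>w\<close>.\<close>

lemma frame_combination: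
  "a *\<^sub>R frame_trans 3 g + b *\<^sub>R frame_rot 1 g + c *\<^sub>R frame_rot 2 g
    = (a *\<^sub>R (snd g *v e_z), \<chi> i. cross3 (snd g $ i) (vector [b, c, 0]))"
  by (simp add: frame_trans_def frame_rot_def sigma_def matrix_def matrix_matrix_mult_def
      cross3_def vec_eq_iff forall_3 sum_3 vector_3 axis_def algebra_simps)

text \<open>Decouples the system into an autonomous quadratic equation for rotation and momentum and
  a quadrature for the position.\<close>

lemma hamiltonian_solution_iff:
  "hamiltonian_solution \<xi> I \<gamma> l \<longleftrightarrow> (\<forall>t\<in>I. \<gamma> t \<in> SE3 \<and> hamiltonian \<xi> (l t) = 1/2 \<and>
    ((\<lambda>t. fst (\<gamma> t)) has_vector_derivative (l t $ 3 / \<xi>\<^sup>2) *\<^sub>R (snd (\<gamma> t) *v e_z)) (at t within I) \<and>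
    (lp_state \<gamma> l has_vector_derivative lie_poisson \<xi> (lp_state \<gamma> l t) (lp_state \<gamma> l t)) (at t within I))"
  unfolding hamiltonian_solution_def frame_combination
    has_vector_derivative_Pair_iff[of \<gamma>] has_vector_derivative_Pair_iff[of "lp_state \<gamma> l"]
    has_vector_derivative_Pair_iff[of "\<lambda>t. snd (lp_state \<gamma> l t)"]
    has_vector_derivative_vec_iff[of "\<lambda>t. fst (snd (lp_state \<gamma> l t))"]
    has_vector_derivative_vec_iff[of "\<lambda>t. snd (snd (lp_state \<gamma> l t))"]
    has_real_derivative_iff_has_vector_derivative
  by (intro ball_cong refl)
    (simp add: lp_state_def lie_poisson_def eta_def cross3_def forall_3 vector_3 mult.commute conj_ac)

lemma hamiltonian_solution_unique:
  assumes sol: "hamiltonian_solution \<xi> {0..T} \<gamma> l" "hamiltonian_solution \<xi> {0..T} \<gamma>' l'"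
    and init: "\<gamma> 0 = \<gamma>' 0" "l 0 = l' 0" and t: "t \<in> {0..T}"
  shows "\<gamma> t = \<gamma>' t" "l t = l' t"
proof -
  have der: "(lp_state \<gamma> l has_vector_derivative lie_poisson \<xi> (lp_state \<gamma> l s) (lp_state \<gamma> l s)) (at s within {0..T})"
     "(lp_state \<gamma>' l' has_vector_derivative lie_poisson \<xi> (lp_state \<gamma>' l' s) (lp_state \<gamma>' l' s)) (at s within {0..T})"
    if "s \<in> {0..T}" for s
    using sol that unfolding hamiltonian_solution_iff by blast+
  \<comment> \<open>The quadratic field is Lipschitz on balls; compactness of the two trajectories
    supplies a common ball.\<close>
  have "compact (lp_state \<gamma> l ` {0..T} \<union> lp_state \<gamma>' l' ` {0..T})"
    by (intro compact_Un compact_continuous_image continuous_on_vector_derivative[OF der(1)]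
        continuous_on_vector_derivative[OF der(2)] compact_Icc)
  then obtain B where "\<forall>y \<in> lp_state \<gamma> l ` {0..T} \<union> lp_state \<gamma>' l' ` {0..T}. norm y \<le> B"
    using compact_imp_bounded bounded_iff by metis
  then have B: "\<And>s. s \<in> {0..T} \<Longrightarrow> lp_state \<gamma> l s \<in> cball 0 B"
      "\<And>s. s \<in> {0..T} \<Longrightarrow> lp_state \<gamma>' l' s \<in> cball 0 B"
    by auto
  obtain L where L: "L-lipschitz_on (cball 0 B) (\<lambda>y. lie_poisson \<xi> y y)"
    using bounded_bilinear_quadratic_lipschitz[OF bounded_bilinear_lie_poisson] by blast
  have state: "lp_state \<gamma> l s = lp_state \<gamma>' l' s" if "s \<in> {0..T}" for s
    by (rule ivp_unique[OF L der B _ that]) (simp_all add: lp_state_def init)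
  then have snd: "snd (\<gamma> s) = snd (\<gamma>' s)" and l: "l s = l' s" if "s \<in> {0..T}" for s
    using that by (auto simp: lp_state_def vec_eq_iff[of "l s"] forall_6 vec_eq_iff forall_3 vector_3)
  have "fst (\<gamma> t) - fst (\<gamma>' t) = fst (\<gamma> 0) - fst (\<gamma>' 0)"
  proof (rule has_vector_derivative_zero_imp_eq[OF _ t])
    fix s assume s: "s \<in> {0..T}"
    then have "((\<lambda>t. fst (\<gamma> t)) has_vector_derivative (l s $ 3 / \<xi>\<^sup>2) *\<^sub>R (snd (\<gamma> s) *v e_z)) (at s within {0..T})"
      "((\<lambda>t. fst (\<gamma>' t)) has_vector_derivative (l' s $ 3 / \<xi>\<^sup>2) *\<^sub>R (snd (\<gamma>' s) *v e_z)) (at s within {0..T})"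
      using sol unfolding hamiltonian_solution_iff by blast+
    from has_vector_derivative_diff[OF this]
    show "((\<lambda>t. fst (\<gamma> t) - fst (\<gamma>' t)) has_vector_derivative 0) (at s within {0..T})"
      by (simp add: snd[OF s] l[OF s])
  qed
  then show "\<gamma> t = \<gamma>' t" using snd[OF t] init by (simp add: prod_eq_iff)
  show "l t = l' t" by (rule l[OF t])
qed

text \<open>A single pair \<open>\<gamma>\<close>, \<open>l\<close> serves for all \<open>T\<close>,
  so that the end points at all times can be read off one curve.\<close>

lemma geodesic_exists:
  assumes H: "hamiltonian \<xi> l0 = 1/2"
  obtains \<gamma> l where "\<gamma> 0 = se3_one" "l 0 = l0" "\<And>T. hamiltonian_solution \<xi> {0..T} \<gamma> l"
proof -
  define p0 q0 :: "real^3" where "p0 = vector [l0 $ 1, l0 $ 2, l0 $ 3]" and "q0 = vector [l0 $ 4, l0 $ 5, l0 $ 6]"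
  have E0: "(p0 $ 3)\<^sup>2 / \<xi>\<^sup>2 + (q0 $ 1)\<^sup>2 + (q0 $ 2)\<^sup>2 = 1"
    using H[unfolded hamiltonian_def divide_cancel_right] unfolding p0_def q0_def vector_3 by simp
  obtain y where y0: "y 0 = (mat 1, p0, q0)" and
    y: "\<And>t. 0 \<le> t \<Longrightarrow> (y has_vector_derivative lie_poisson \<xi> (y t) (y t)) (at t within {0..})"
    using lie_poisson_global_solution[OF E0] by blast
  have yT: "(y has_vector_derivative 1 *\<^sub>R lie_poisson \<xi> (y t) (y t)) (at t within {0..T})"
    if "t \<in> {0..T}" for t T
    using y[of t] that by (auto intro: has_vector_derivative_within_subset)
  define l where "l t = covector (fst (snd (y t))) (snd (snd (y t)))" for t
  define v where "v t = (l t $ 3 / \<xi>\<^sup>2) *\<^sub>R (fst (y t) *v e_z)" for t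
  define \<gamma> where "\<gamma> t = (integral {0..t} v, fst (y t))" for t
  have ycont: "continuous_on {0..T} y" for T
    using yT by (intro continuous_on_vector_derivative)
  then have vcont: "continuous_on {0..T} v" for T
    unfolding v_def l_def covector_nth divide_inverse matrix_vector_mult_basis column_def
    by (intro continuous_intros)
  have state: "lp_state \<gamma> l = y"
    by (auto simp: fun_eq_iff lp_state_def \<gamma>_def l_def prod_eq_iff vec_eq_iff forall_3 vector_3)
  show thesis
  proof
    show "\<gamma> 0 = se3_one" by (simp add: \<gamma>_def se3_one_def y0)
    show "l 0 = l0"
      by (simp add: l_def y0 p0_def q0_def vec_eq_iff forall_6 vector_3)
    fix T
    show "hamiltonian_solution \<xi> {0..T} \<gamma> l"
      unfolding hamiltonian_solution_iff state
    proof (intro ballI conjI)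
      fix t assume t: "t \<in> {0..T}"
      have "rotation_matrix (mat 1 :: real^3^3)"
        by (simp add: rotation_matrix_def orthogonal_matrix_id)
      then show "\<gamma> t \<in> SE3"
        using lie_poisson_rotation[OF yT _ t] by (simp add: y0 SE3_def \<gamma>_def)
      show "hamiltonian \<xi> (l t) = 1/2"
        using lie_poisson_energy[OF yT t] E0 by (simp add: y0 hamiltonian_def l_def)
      show "((\<lambda>t. fst (\<gamma> t)) has_vector_derivative (l t $ 3 / \<xi>\<^sup>2) *\<^sub>R (snd (\<gamma> t) *v e_z)) (at t within {0..T})"
        using integral_has_vector_derivative[OF vcont t] by (simp add: \<gamma>_def v_def)
      show "(y has_vector_derivative lie_poisson \<xi> (y t) (y t)) (at t within {0..T})"
        using yT[OF t] by simp
    qed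
  qed
qed

text \<open>Uniqueness of geodesics on \<open>{0..t}\<close> evaluates the description operator: any
  geodesic with the right initial momentum gives its value.\<close>

lemma Exp_SE3_eq:
  assumes "PMEC_geodesic \<xi> t \<gamma> l" "l 0 = l0" "0 \<le> t"
  shows "Exp_SE3 \<xi> l0 t = \<gamma> t"
  unfolding Exp_SE3_def
proof (rule the_equality)
  show "\<exists>\<gamma>' l. PMEC_geodesic \<xi> t \<gamma>' l \<and> l 0 = l0 \<and> \<gamma>' t = \<gamma> t"
    using assms by blast
  fix g assume "\<exists>\<gamma> l. PMEC_geodesic \<xi> t \<gamma> l \<and> l 0 = l0 \<and> \<gamma> t = g"
  then show "g = \<gamma> t"
    using hamiltonian_solution_unique(1)[of \<xi> t _ _ \<gamma> l t] assms
    by (auto simp: PMEC_geodesic_def)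
qed

section \<open>The control \<open>u\<^sup>3\<close> in terms of the momentum\<close>

lemma frame_sum:
  "(\<Sum>i\<in>UNIV. (fst c $ i) *\<^sub>R frame_trans i g) + (\<Sum>i\<in>UNIV. (snd c $ i) *\<^sub>R frame_rot i g)
    = (snd g *v fst c, snd g ** sigma (snd c))"
  by (simp add: frame_trans_def frame_rot_def sigma_def matrix_def matrix_matrix_mult_def
      matrix_vector_mult_def cross3_def vec_eq_iff forall_3 sum_3 vector_3 axis_def algebra_simps)

text \<open>The coordinates are unique because \<open>snd g\<close> is orthogonal, hence can be
  cancelled, and \<open>sigma\<close> is injective.\<close>

lemma coframe_eq:
  assumes "g \<in> SE3"
  shows "coframe g (snd g *v a, snd g ** sigma b) = (a, b)"
  unfolding coframe_def frame_sum
proof (rule the_equality)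
  fix c assume c: "(snd g *v a, snd g ** sigma b) = (snd g *v fst c, snd g ** sigma (snd c))"
  have R: "transpose (snd g) ** snd g = mat 1"
    using assms by (auto simp: SE3_def rotation_matrix_def orthogonal_matrix_def)
  have "transpose (snd g) *v (snd g *v a) = transpose (snd g) *v (snd g *v fst c)"
    "transpose (snd g) ** (snd g ** sigma b) = transpose (snd g) ** (snd g ** sigma (snd c))"
    using c by auto
  then have "a = fst c" "sigma b = sigma (snd c)"
    by (simp_all add: matrix_vector_mul_assoc matrix_mul_assoc R)
  then show "c = (a, b)"
    by (simp add: prod_eq_iff sigma_def matrix_def cross3_def vec_eq_iff forall_3 vector_3 axis_def)
qed simp

lemma omega3_frame_combination:
  assumes "g \<in> SE3"
  shows "omega3 g (a *\<^sub>R frame_trans 3 g + b *\<^sub>R frame_rot 1 g + c *\<^sub>R frame_rot 2 g) = a"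
proof -
  have "a *\<^sub>R frame_trans 3 g + b *\<^sub>R frame_rot 1 g + c *\<^sub>R frame_rot 2 g
      = (snd g *v vector [0, 0, a], snd g ** sigma (vector [b, c, 0]))"
    using frame_sum[of "(vector [0, 0, a], vector [b, c, 0])" g] by (simp add: sum_3 vector_3 add.assoc)
  then show ?thesis by (simp add: omega3_def coframe_eq[OF assms] vector_3)
qed

text \<open>Stated for interior times, where the two-sided derivative in \<open>u3\<close> agrees
  with the derivative within the interval.\<close>

lemma u3_hamiltonian_solution:
  assumes "hamiltonian_solution \<xi> {0..T} \<gamma> l" "0 < t" "t < T"
  shows "u3 \<gamma> t = l t $ 3 / \<xi>\<^sup>2"
proof -
  have t: "t \<in> {0..T}" using assms by simp
  from assms(1) t have "\<gamma> t \<in> SE3" and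
    "(\<gamma> has_vector_derivative (l t $ 3 / \<xi>\<^sup>2) *\<^sub>R frame_trans 3 (\<gamma> t) + (l t $ 4) *\<^sub>R frame_rot 1 (\<gamma> t)
          + (l t $ 5) *\<^sub>R frame_rot 2 (\<gamma> t)) (at t within {0..T})"
    unfolding hamiltonian_solution_def by blast+
  then show ?thesis
    using assms unfolding u3_def
    by (simp add: at_within_Icc_at vector_derivative_at omega3_frame_combination)
qed

section \<open>Spatial arclength\<close>

text \<open>The new curve has tangent \<open>n t0\<close> even where the speed
  \<open>\<sigma>'\<close> vanishes. The increments of \<open>x\<close> are compared with those of
  \<open>\<sigma>\<close> directly, so no division by \<open>\<sigma>'\<close> occurs.\<close>

lemma arclength_reparametrization_derivative:
  fixes x n :: "real \<Rightarrow> 'a::real_normed_vector"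
  assumes "0 < T" and \<sigma>0: "\<sigma> 0 = 0"
    and \<sigma>: "\<And>t. t \<in> {0..T} \<Longrightarrow> (\<sigma> has_real_derivative \<sigma>' t) (at t within {0..T})"
    and nonneg: "\<And>t. t \<in> {0..T} \<Longrightarrow> 0 \<le> \<sigma>' t"
    and mono: "strict_mono_on {0..T} \<sigma>"
    and x: "\<And>t. t \<in> {0..T} \<Longrightarrow> (x has_vector_derivative \<sigma>' t *\<^sub>R n t) (at t within {0..T})"
    and n: "continuous_on {0..T} n"
    and \<tau>: "\<And>t. t \<in> {0..T} \<Longrightarrow> \<tau> (\<sigma> t) = t"
    and t0: "t0 \<in> {0..T}"
  shows "((\<lambda>s. x (\<tau> s)) has_vector_derivative n t0) (at (\<sigma> t0) within {0..\<sigma> T})"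
proof -
  have \<sigma>cont: "continuous_on {0..T} \<sigma>"
    by (rule DERIV_continuous_on[OF \<sigma>])
  have xcont: "continuous_on {0..T} x"
    by (rule continuous_on_vector_derivative[OF x])
  have le: "\<sigma> a \<le> \<sigma> b" if "a \<in> {0..T}" "b \<in> {0..T}" "a \<le> b" for a b
    using strict_mono_onD[OF mono, of a b] that by (cases "a = b") auto
  have img: "\<sigma> ` {0..T} = {0..\<sigma> T}"
  proof
    show "\<sigma> ` {0..T} \<subseteq> {0..\<sigma> T}"
      using le[of 0] le[of _ T] \<sigma>0 \<open>0 < T\<close> by auto
    show "{0..\<sigma> T} \<subseteq> \<sigma> ` {0..T}"
    proof
      fix s assume "s \<in> {0..\<sigma> T}"
      then obtain t where "0 \<le> t" "t \<le> T" "\<sigma> t = s"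
        using IVT'[of \<sigma> 0 s T] \<sigma>0 \<sigma>cont \<open>0 < T\<close> by auto
      then show "s \<in> \<sigma> ` {0..T}" by auto
    qed
  qed
  \<comment> \<open>The inverse of a continuous injection on a compact set is continuous.\<close>
  have \<tau>cont: "continuous_on {0..\<sigma> T} \<tau>"
    using continuous_on_inv[OF \<sigma>cont] \<tau> img by simp
  \<comment> \<open>Mean value inequality for \<open>x r - \<sigma> r *\<^sub>R n t0\<close>: its
    derivative \<open>\<sigma>' r *\<^sub>R (n r - n t0)\<close> has norm at most
    \<open>e * \<sigma>' r\<close>.\<close>
  have bound: "norm (x b - x a - (\<sigma> b - \<sigma> a) *\<^sub>R n t0) \<le> e * (\<sigma> b - \<sigma> a)"
    if ab: "0 \<le> a" "a \<le> b" "b \<le> T" and e: "\<And>r. r \<in> {a..b} \<Longrightarrow> norm (n r - n t0) \<le> e" for a b e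
  proof (cases "a = b")
    case False
    define D where "D r = x r - \<sigma> r *\<^sub>R n t0" for r
    have "norm (D b - D a) \<le> e * \<sigma> b - e * \<sigma> a"
    proof (rule differentiable_bound_general[where f' = "\<lambda>r. \<sigma>' r *\<^sub>R n r - \<sigma>' r *\<^sub>R n t0" and \<phi>' = "\<lambda>r. e * \<sigma>' r"])
      show "a < b" using ab False by simp
      have sub: "{a..b} \<subseteq> {0..T}" using ab by auto
      show "continuous_on {a..b} D" unfolding D_def
        using continuous_on_subset[OF xcont sub] continuous_on_subset[OF \<sigma>cont sub]
        by (intro continuous_intros)
      show "continuous_on {a..b} (\<lambda>r. e * \<sigma> r)"
        using continuous_on_subset[OF \<sigma>cont sub] by (intro continuous_intros)
      fix r assume r: "a < r" "r < b"
      then have r': "r \<in> {0..T}" "at r within {0..T} = at r"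
        using ab by (auto intro!: at_within_Icc_at)
      have d: "(\<sigma> has_real_derivative \<sigma>' r) (at r)" "(x has_vector_derivative \<sigma>' r *\<^sub>R n r) (at r)"
        using \<sigma>[OF r'(1)] x[OF r'(1)] unfolding r'(2) by auto
      show "(D has_vector_derivative \<sigma>' r *\<^sub>R n r - \<sigma>' r *\<^sub>R n t0) (at r)"
        unfolding D_def using d by (auto intro!: derivative_eq_intros)
      show "((\<lambda>r. e * \<sigma> r) has_vector_derivative e * \<sigma>' r) (at r)"
        unfolding has_real_derivative_iff_has_vector_derivative[symmetric]
        using d(1) by (auto intro!: derivative_eq_intros)
      have "norm (\<sigma>' r *\<^sub>R n r - \<sigma>' r *\<^sub>R n t0) = \<sigma>' r * norm (n r - n t0)"
        using nonneg[OF r'(1)] by (simp flip: scaleR_diff_right)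
      also have "\<dots> \<le> \<sigma>' r * e"
        using e[of r] r nonneg[OF r'(1)] by (intro mult_left_mono) auto
      finally show "norm (\<sigma>' r *\<^sub>R n r - \<sigma>' r *\<^sub>R n t0) \<le> e * \<sigma>' r" by (simp add: mult.commute)
    qed
    then show ?thesis by (simp add: D_def algebra_simps)
  qed simp
  show ?thesis
    unfolding has_vector_derivative_def has_derivative_within_alt
  proof (intro conjI allI impI)
    show "bounded_linear (\<lambda>h. h *\<^sub>R n t0)" by (rule bounded_linear_scaleR_left)
    fix e :: real assume "0 < e"
    \<comment> \<open>Continuity of \<open>n\<close> gives \<open>\<delta>\<close> in the old
      parameter; continuity of \<open>\<tau>\<close> turns it into a distance \<open>d\<close> in
      the new one.\<close>
    then obtain \<delta> where \<delta>: "0 < \<delta>" "\<And>r. r \<in> {0..T} \<Longrightarrow> dist r t0 < \<delta> \<Longrightarrow> dist (n r) (n t0) < e"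
      using n t0 unfolding continuous_on_iff by blast
    obtain d where d: "0 < d" "\<And>s. s \<in> {0..\<sigma> T} \<Longrightarrow> dist s (\<sigma> t0) < d \<Longrightarrow> dist (\<tau> s) (\<tau> (\<sigma> t0)) < \<delta>"
      using \<tau>cont img t0 \<delta>(1) unfolding continuous_on_iff by blast
    show "\<exists>d>0. \<forall>s\<in>{0..\<sigma> T}. norm (s - \<sigma> t0) < d \<longrightarrow>
      norm (x (\<tau> s) - x (\<tau> (\<sigma> t0)) - (s - \<sigma> t0) *\<^sub>R n t0) \<le> e * norm (s - \<sigma> t0)"
    proof (intro exI[of _ d] conjI ballI impI)
      fix s assume s: "s \<in> {0..\<sigma> T}" "norm (s - \<sigma> t0) < d"
      then obtain t where t: "t \<in> {0..T}" "s = \<sigma> t" using img by blast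
      have close: "\<bar>t - t0\<bar> < \<delta>"
        using d(2)[of s] s t t0 \<tau> by (simp add: dist_norm)
      have ne: "norm (n r - n t0) \<le> e" if "r \<in> {min t t0..max t t0}" for r
        using \<delta>(2)[of r] that close t t0 by (auto simp: dist_norm min_def max_def split: if_splits)
      show "norm (x (\<tau> s) - x (\<tau> (\<sigma> t0)) - (s - \<sigma> t0) *\<^sub>R n t0) \<le> e * norm (s - \<sigma> t0)"
      proof (cases "t \<le> t0")
        case True
        then have "norm (x t0 - x t - (\<sigma> t0 - \<sigma> t) *\<^sub>R n t0) \<le> e * (\<sigma> t0 - \<sigma> t)"
          using bound[of t t0 e] t t0 ne by auto
        moreover have "x t - x t0 - (\<sigma> t - \<sigma> t0) *\<^sub>R n t0 = - (x t0 - x t - (\<sigma> t0 - \<sigma> t) *\<^sub>R n t0)"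
          by (simp add: algebra_simps)
        ultimately show ?thesis
          using True t t0 le[of t t0] \<tau> by (metis abs_minus_commute abs_of_nonneg diff_ge_0_iff_ge norm_minus_cancel real_norm_def)
      next
        case False
        then have "norm (x t - x t0 - (\<sigma> t - \<sigma> t0) *\<^sub>R n t0) \<le> e * (\<sigma> t - \<sigma> t0)"
          using bound[of t0 t e] t t0 ne by auto
        then show ?thesis
          using False t t0 le[of t0 t] \<tau> by simp
      qed
    qed (rule d(1))
  qed
qed

text \<open>The sign is recorded as a factor \<open>\<epsilon>\<close>, so that forward and backward
  motion can be treated by one computation.\<close>

lemma nonzero_constant_sign:
  fixes f :: "real \<Rightarrow> real"
  assumes "connected S" "continuous_on S f" "\<And>t. t \<in> S \<Longrightarrow> f t \<noteq> 0"
  obtains \<epsilon> :: real where "\<bar>\<epsilon>\<bar> = 1" "\<And>t. t \<in> S \<Longrightarrow> 0 < \<epsilon> * f t"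
proof (cases "\<exists>a\<in>S. f a < 0")
  case True
  then obtain a where a: "a \<in> S" "f a < 0" by blast
  have "f t < 0" if "t \<in> S" for t
  proof (rule ccontr)
    assume "\<not> f t < 0"
    then have "0 \<in> f ` S"
      using connectedD_interval[OF connected_continuous_image[OF assms(2,1)], of "f a" "f t" 0] a that by auto
    with assms(3) show False by auto
  qed
  then show thesis by (intro that[of "-1"]) auto
next
  case False
  then show thesis using assms(3) by (intro that[of 1]) (auto simp: not_less le_less)
qed

text \<open>A positive concave function on a half-line is nondecreasing.\<close>

lemma positive_concave_primitive_unbounded:
  fixes w w' \<sigma> :: "real \<Rightarrow> real"
  assumes w: "\<And>t. 0 < t \<Longrightarrow> (w has_real_derivative w' t) (at t)"
    and w': "\<And>t. 0 < t \<Longrightarrow> \<exists>c\<le>0. (w' has_real_derivative c) (at t)"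
    and pos: "\<And>t. 0 < t \<Longrightarrow> 0 < w t" and "0 < k"
    and \<sigma>: "\<And>t. 0 < t \<Longrightarrow> (\<sigma> has_real_derivative k * w t) (at t)"
  shows "\<exists>t>0. K < \<sigma> t"
proof -
  have dec: "w' b \<le> w' a" if "0 < a" "a \<le> b" for a b
  proof (rule DERIV_nonpos_imp_nonincreasing[OF that(2)])
    fix t assume "a \<le> t"
    then show "\<exists>y. (w' has_real_derivative y) (at t) \<and> y \<le> 0" using w'[of t] that(1) by auto
  qed
  have nonneg: "0 \<le> w' a" if a: "0 < a" for a
  proof (rule ccontr)
    assume "\<not> 0 \<le> w' a"
    then have neg: "w' a < 0" by simp
    \<comment> \<open>The zero of the tangent line to \<open>w\<close> at \<open>a\<close>;
      concavity keeps \<open>w\<close> below this line.\<close>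
    define b where "b = a + w a / - w' a"
    have ab: "a \<le> b" using pos[OF a] neg by (simp add: b_def divide_nonneg_neg less_imp_le)
    have "w b - w' a * b \<le> w a - w' a * a"
    proof (rule DERIV_nonpos_imp_nonincreasing[OF ab])
      fix t assume t: "a \<le> t" "t \<le> b"
      have "((\<lambda>t. w t - w' a * t) has_real_derivative w' t - w' a) (at t)"
        using w[of t] a t by (auto intro!: derivative_eq_intros)
      then show "\<exists>y. ((\<lambda>t. w t - w' a * t) has_real_derivative y) (at t) \<and> y \<le> 0"
        using dec[of a t] a t by auto
    qed
    moreover have "w' a * b = w' a * a - w a" using neg by (simp add: b_def field_simps)
    ultimately have "w b \<le> 0" by simp
    then show False using pos[of b] ab a by simp
  qed
  have winc: "w 1 \<le> w t" if "1 \<le> t" for t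
  proof (rule DERIV_nonneg_imp_nondecreasing[OF that])
    fix r :: real assume "1 \<le> r"
    then show "\<exists>y. (w has_real_derivative y) (at r) \<and> 0 \<le> y"
      using w[of r] nonneg[of r] by auto
  qed
  define c where "c = k * w 1"
  have c: "0 < c" using pos[of 1] \<open>0 < k\<close> by (simp add: c_def)
  \<comment> \<open>From time 1 on, \<open>\<sigma>\<close> grows at rate at least \<open>c\<close>,
    and \<open>c * (t - 1)\<close> exceeds \<open>K - \<sigma> 1\<close>.\<close>
  define t where "t = 1 + \<bar>K - \<sigma> 1\<bar> / c + 1"
  have t: "1 \<le> t" using c by (simp add: t_def)
  have "\<sigma> 1 - c * 1 \<le> \<sigma> t - c * t"
  proof (rule DERIV_nonneg_imp_nondecreasing[OF t])
    fix r assume r: "1 \<le> r" "r \<le> t"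
    have "((\<lambda>t. \<sigma> t - c * t) has_real_derivative k * w r - c) (at r)"
      using \<sigma>[of r] r by (auto intro!: derivative_eq_intros)
    moreover have "0 \<le> k * w r - c" using winc[OF r(1)] \<open>0 < k\<close> by (simp add: c_def)
    ultimately show "\<exists>y. ((\<lambda>t. \<sigma> t - c * t) has_real_derivative y) (at r) \<and> 0 \<le> y" by blast
  qed
  moreover have "c * t = c + \<bar>K - \<sigma> 1\<bar> + c" using c by (simp add: t_def field_simps)
  ultimately have "K < \<sigma> t" using c by linarith
  then show ?thesis using t by (intro exI[of _ t]) auto
qed

section \<open>Spatial arclength and cusps of one geodesic defined for all times\<close>

locale global_geodesic =
  fixes \<xi> :: real and l0 :: "real^6" and \<gamma> :: "real \<Rightarrow> se3" and l :: "real \<Rightarrow> real^6"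
  assumes \<xi>: "0 < \<xi>" and init: "\<gamma> 0 = se3_one" "l 0 = l0"
    and sol: "\<And>T. hamiltonian_solution \<xi> {0..T} \<gamma> l"
begin

text \<open>The spatial speed is written through the momentum, which is continuous up to time 0 and
  past cusps.\<close>

definition arclength :: "real \<Rightarrow> real" where
  "arclength t = integral {0..t} (\<lambda>\<tau>. \<bar>l \<tau> $ 3\<bar> / \<xi>\<^sup>2)"

lemma Exp_SE3_eq_geodesic: "0 \<le> t \<Longrightarrow> Exp_SE3 \<xi> l0 t = \<gamma> t"
  using Exp_SE3_eq[of \<xi> t \<gamma> l l0] sol init by (simp add: PMEC_geodesic_def)

lemma rotation: "0 \<le> t \<Longrightarrow> rotation_matrix (snd (\<gamma> t))"
  using sol[of t] unfolding hamiltonian_solution_def SE3_def by (metis (no_types, lifting) atLeastAtMost_iff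
      order_refl case_prod_beta mem_Collect_eq)

lemma continuous_on_l3: "continuous_on {0..T} (\<lambda>t. l t $ 3)"
  using sol[of T] unfolding hamiltonian_solution_def by (intro DERIV_continuous_on) blast

lemma continuous_on_tangent: "continuous_on {0..T} (\<lambda>t. snd (\<gamma> t) *v e_z)"
proof -
  have "continuous_on {0..T} \<gamma>"
    using sol[of T] unfolding hamiltonian_solution_def by (intro continuous_on_vector_derivative) blast
  then show ?thesis
    unfolding matrix_vector_mult_basis column_def by (intro continuous_intros)
qed

lemma position_derivative:
  "t \<in> {0..T} \<Longrightarrow> ((\<lambda>t. fst (\<gamma> t)) has_vector_derivative (l t $ 3 / \<xi>\<^sup>2) *\<^sub>R (snd (\<gamma> t) *v e_z)) (at t within {0..T})"
  using sol[of T] unfolding hamiltonian_solution_iff by blast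

lemma norm_tangent: "0 \<le> t \<Longrightarrow> norm (snd (\<gamma> t) *v e_z) = 1"
  using rotation[of t] by (simp add: rotation_matrix_def orthogonal_matrix_orthonormal_columns
      matrix_vector_mult_basis)

lemma Exp_SE3_derivative:
  assumes "0 < t" "(\<gamma> has_vector_derivative v) (at t)"
  shows "(Exp_SE3 \<xi> l0 has_vector_derivative v) (at t)"
  using assms(2)
  by (rule has_vector_derivative_transform_within_open[of _ _ _ "{0<..}"])
    (use assms(1) Exp_SE3_eq_geodesic in auto)

lemma u3_Exp_SE3:
  assumes "0 < t"
  shows "u3 (Exp_SE3 \<xi> l0) t = l t $ 3 / \<xi>\<^sup>2"
proof -
  have "t \<in> {0..t+1}" using assms by simp
  then obtain v where "(\<gamma> has_vector_derivative v) (at t within {0..t+1})"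
    using sol[of "t+1"] unfolding hamiltonian_solution_def by blast
  then have "(\<gamma> has_vector_derivative v) (at t)"
    using at_within_Icc_at[of 0 t "t+1"] assms by simp
  then have "vector_derivative (Exp_SE3 \<xi> l0) (at t) = vector_derivative \<gamma> (at t)"
    using Exp_SE3_derivative[OF assms] vector_derivative_at by metis
  then have "u3 (Exp_SE3 \<xi> l0) t = u3 \<gamma> t"
    using assms by (simp add: u3_def Exp_SE3_eq_geodesic)
  then show ?thesis
    using u3_hamiltonian_solution[OF sol, of t "t+1"] assms by simp
qed

lemma cusp_time_eq: "cusp_time \<xi> l0 = Inf {ereal t | t. 0 < t \<and> l t $ 3 = 0}"
proof -
  have "0 < t \<and> u3 (Exp_SE3 \<xi> l0) t = 0 \<longleftrightarrow> 0 < t \<and> l t $ 3 = 0" for t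
    using u3_Exp_SE3[of t] \<xi> by auto
  then show ?thesis unfolding cusp_time_def by simp
qed

lemma nonzero_before_cusp: "0 < t \<Longrightarrow> ereal t < cusp_time \<xi> l0 \<Longrightarrow> l t $ 3 \<noteq> 0"
  using Inf_lower[of "ereal t" "{ereal t | t. 0 < t \<and> l t $ 3 = 0}"] unfolding cusp_time_eq
  by (auto simp: not_le[symmetric])

lemma le_cusp_timeI: "(\<And>t. 0 < t \<Longrightarrow> t < T \<Longrightarrow> l t $ 3 \<noteq> 0) \<Longrightarrow> ereal T \<le> cusp_time \<xi> l0"
  unfolding cusp_time_eq by (rule Inf_greatest) force

text \<open>The two integrands agree except possibly at 0, where the two-sided derivative involves
  unspecified values of \<open>Exp_SE3\<close> at negative times; a single point does not affect the
  integral.\<close>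

lemma spatial_length_eq:
  assumes "0 \<le> t"
  shows "spatial_length \<xi> l0 t = arclength t"
  unfolding spatial_length_def arclength_def
proof (rule integral_spike[of "{0}"])
  fix r assume r: "r \<in> {0..t} - {0}"
  then have "((\<lambda>t. fst (\<gamma> t)) has_vector_derivative (l r $ 3 / \<xi>\<^sup>2) *\<^sub>R (snd (\<gamma> r) *v e_z)) (at r)"
    using position_derivative[of r "r + 1"] at_within_Icc_at[of 0 r "r+1"] by simp
  then have "((\<lambda>t. fst (Exp_SE3 \<xi> l0 t)) has_vector_derivative (l r $ 3 / \<xi>\<^sup>2) *\<^sub>R (snd (\<gamma> r) *v e_z)) (at r)"
    by (rule has_vector_derivative_transform_within_open[of _ _ _ "{0<..}"])
      (use r Exp_SE3_eq_geodesic in auto)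
  then show "\<bar>l r $ 3\<bar> / \<xi>\<^sup>2 = norm (vector_derivative (\<lambda>\<rho>. fst (Exp_SE3 \<xi> l0 \<rho>)) (at r))"
    using r norm_tangent[of r] by (simp add: vector_derivative_at)
qed simp

lemma arclength_derivative:
  "t \<in> {0..T} \<Longrightarrow> (arclength has_real_derivative \<bar>l t $ 3\<bar> / \<xi>\<^sup>2) (at t within {0..T})"
  unfolding arclength_def using \<xi>
  by (intro integral_has_real_derivative continuous_intros continuous_on_l3) auto

lemma arclength_0: "arclength 0 = 0"
  by (simp add: arclength_def)

text \<open>The speed is positive inside the interval, which suffices; so \<open>b\<close> may be
  the cusp time itself and \<open>a\<close> may be 0.\<close>

lemma arclength_strict_mono:
  assumes "0 \<le> a" "a < b" "ereal b \<le> cusp_time \<xi> l0"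
  shows "arclength a < arclength b"
proof (rule DERIV_pos_imp_increasing_open[OF assms(2)])
  show "continuous_on {a..b} arclength"
    using DERIV_continuous_on[OF arclength_derivative, of b] assms(1)
    by (auto intro: continuous_on_subset)
  fix t assume t: "a < t" "t < b"
  then have "ereal t < cusp_time \<xi> l0"
    using assms(3) less_le_trans[of "ereal t" "ereal b"] by simp
  then have "0 < \<bar>l t $ 3\<bar> / \<xi>\<^sup>2"
    using nonzero_before_cusp[of t] t assms(1) \<xi> by simp
  moreover have "(arclength has_real_derivative \<bar>l t $ 3\<bar> / \<xi>\<^sup>2) (at t)"
    using arclength_derivative[of t b] t assms(1) at_within_Icc_at[of 0 t b] by simp
  ultimately show "\<exists>y. (arclength has_real_derivative y) (at t) \<and> 0 < y" by blast
qed

lemma sr_time_arclength: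
  assumes "0 \<le> t" "ereal t \<le> cusp_time \<xi> l0"
  shows "sr_time \<xi> l0 (arclength t) = t"
  unfolding sr_time_def
proof (rule the_equality)
  fix r assume r: "0 \<le> r \<and> ereal r \<le> cusp_time \<xi> l0 \<and> spatial_length \<xi> l0 r = arclength t"
  then show "r = t"
    using assms arclength_strict_mono[of r t] arclength_strict_mono[of t r] spatial_length_eq[of r]
    by (cases r t rule: linorder_cases) auto
qed (use assms spatial_length_eq in auto)

text \<open>Time 0 is excluded because a geodesic may start with
  \<open>\<lambda>\<^sub>3 = 0\<close>.\<close>

lemma sign_before_cusp:
  obtains \<epsilon> :: real where "\<bar>\<epsilon>\<bar> = 1"
    "\<And>t. 0 < t \<Longrightarrow> ereal t < cusp_time \<xi> l0 \<Longrightarrow> 0 < \<epsilon> * l t $ 3"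
proof -
  let ?S = "{t. 0 < t \<and> ereal t < cusp_time \<xi> l0}"
  have "is_interval ?S"
    unfolding is_interval_1 by (auto intro: le_less_trans[of "ereal _" "ereal _"])
  then have "connected ?S" by (rule is_interval_connected)
  moreover have "continuous_on {0..} (\<lambda>t. l t $ 3)"
    unfolding continuous_on_eq_continuous_within
  proof
    fix t :: real assume "t \<in> {0..}"
    then show "continuous (at t within {0..}) (\<lambda>t. l t $ 3)"
      using continuous_on_l3[of "t+1", unfolded continuous_on_eq_continuous_within]
        at_within_atLeast_eq_atLeastAtMost[of t "t+1"] by simp
  qed
  then have "continuous_on ?S (\<lambda>t. l t $ 3)"
    by (rule continuous_on_subset) auto
  ultimately show thesis
    by (rule nonzero_constant_sign) (use nonzero_before_cusp that in auto)
qed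

text \<open>Since \<open>\<bar>\<lambda>\<^sub>3\<bar> = \<epsilon> \<lambda>\<^sub>3\<close>, the
  velocity of the position is the spatial speed times \<open>\<epsilon> R e_z\<close>, and the
  reparametrization lemma applies on the closed interval, cusp included.\<close>

lemma x_star_derivative:
  assumes T: "0 < T" "ereal T \<le> cusp_time \<xi> l0"
    and \<epsilon>: "\<bar>\<epsilon>\<bar> = 1" "\<And>t. 0 < t \<Longrightarrow> t < T \<Longrightarrow> 0 < \<epsilon> * l t $ 3"
    and t: "t \<in> {0..T}"
  shows "(x_star \<xi> l0 has_vector_derivative \<epsilon> *\<^sub>R (snd (\<gamma> t) *v e_z))
    (at (arclength t) within {0..arclength T})"
proof -
  have cusp: "ereal r \<le> cusp_time \<xi> l0" if "r \<in> {0..T}" for r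
    using that T(2) order_trans[of "ereal r" "ereal T"] by simp
  have eps: "\<epsilon> * (\<epsilon> * z) = z" for z using \<epsilon>(1) by (auto simp: abs_if split: if_splits)
  have abs: "\<bar>l r $ 3\<bar> = \<epsilon> * l r $ 3" if "r \<in> {0..T}" for r
  proof -
    \<comment> \<open>The weak inequality extends from the open interval to its end points, where
      \<open>\<lambda>\<^sub>3\<close> may vanish.\<close>
    have "closure {0<..<T} \<subseteq> {r \<in> {0..T}. 0 \<le> \<epsilon> * l r $ 3}"
    proof (rule closure_minimal)
      show "{0<..<T} \<subseteq> {r \<in> {0..T}. 0 \<le> \<epsilon> * l r $ 3}"
      proof
        fix r assume "r \<in> {0<..<T}"
        then show "r \<in> {r \<in> {0..T}. 0 \<le> \<epsilon> * l r $ 3}"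
          using \<epsilon>(2)[of r] by simp
      qed
      have "closed ({0..T} \<inter> (\<lambda>r. \<epsilon> * l r $ 3) -` {0..})"
        by (intro continuous_closed_preimage continuous_intros continuous_on_l3 closed_atLeast closed_atLeastAtMost)
      also have "{0..T} \<inter> (\<lambda>r. \<epsilon> * l r $ 3) -` {0..} = {r \<in> {0..T}. 0 \<le> \<epsilon> * l r $ 3}"
        by auto
      finally show "closed {r \<in> {0..T}. 0 \<le> \<epsilon> * l r $ 3}" .
    qed
    then have "0 \<le> \<epsilon> * l r $ 3" using that T(1) by auto
    then show ?thesis using \<epsilon>(1) by (metis abs_mult abs_of_nonneg mult_1)
  qed
  have "((\<lambda>s. fst (\<gamma> (sr_time \<xi> l0 s))) has_vector_derivative \<epsilon> *\<^sub>R (snd (\<gamma> t) *v e_z))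
      (at (arclength t) within {0..arclength T})"
  proof (rule arclength_reparametrization_derivative[where \<sigma>' = "\<lambda>t. \<bar>l t $ 3\<bar> / \<xi>\<^sup>2"
        and x = "\<lambda>t. fst (\<gamma> t)" and n = "\<lambda>t. \<epsilon> *\<^sub>R (snd (\<gamma> t) *v e_z)", OF T(1) arclength_0 arclength_derivative])
    show "strict_mono_on {0..T} arclength"
      by (rule strict_mono_onI) (use arclength_strict_mono cusp in auto)
    fix r assume r: "r \<in> {0..T}"
    show "((\<lambda>t. fst (\<gamma> t)) has_vector_derivative (\<bar>l r $ 3\<bar> / \<xi>\<^sup>2) *\<^sub>R \<epsilon> *\<^sub>R (snd (\<gamma> r) *v e_z)) (at r within {0..T})"
      using position_derivative[OF r] by (simp add: abs[OF r] eps mult.commute[of _ \<epsilon>])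
    show "sr_time \<xi> l0 (arclength r) = r"
      using sr_time_arclength r cusp by auto
  qed (use t in \<open>auto intro!: continuous_intros continuous_on_tangent\<close>)
  then show ?thesis
  proof (rule has_vector_derivative_transform[rotated 2])
    have img: "s \<in> arclength ` {0..T}" if "s \<in> {0..arclength T}" for s
      using IVT'[of arclength 0 s T] that arclength_0 T(1) DERIV_continuous_on[OF arclength_derivative, of T]
      by force
    show "x_star \<xi> l0 s = fst (\<gamma> (sr_time \<xi> l0 s))" if "s \<in> {0..arclength T}" for s
      using img[OF that] sr_time_arclength cusp by (auto simp: x_star_def Exp_SE3_eq_geodesic)
    have "0 \<le> arclength t" "arclength t \<le> arclength T"
      using arclength_strict_mono[of 0 t] arclength_strict_mono[of t T] arclength_0 t T cusp[OF t]
      by (cases "t = 0"; cases "t = T"; auto)+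
    then show "arclength t \<in> {0..arclength T}" by simp
  qed
qed

lemma l6_eq_0:
  assumes "l0 $ 6 = 0" "0 \<le> t"
  shows "l t $ 6 = 0"
proof -
  have "l t $ 6 = l 0 $ 6"
    by (rule has_vector_derivative_zero_imp_eq[of 0 t])
      (use sol[of t] assms(2) in \<open>auto simp: hamiltonian_solution_def has_real_derivative_iff_has_vector_derivative\<close>)
  then show ?thesis by (simp add: init assms(1))
qed

lemma arclength_unbounded:
  assumes "l0 $ 6 = 0" and cusp: "cusp_time \<xi> l0 = \<infinity>"
  shows "\<exists>t>0. K < arclength t"
proof -
  have ders: "((\<lambda>\<tau>. l \<tau> $ 1) has_real_derivative - (l t $ 3 * l t $ 5)) (at t within {0..T})"
     "((\<lambda>\<tau>. l \<tau> $ 2) has_real_derivative l t $ 3 * l t $ 4) (at t within {0..T})"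
     "((\<lambda>\<tau>. l \<tau> $ 3) has_real_derivative l t $ 1 * l t $ 5 - l t $ 2 * l t $ 4) (at t within {0..T})"
     "((\<lambda>\<tau>. l \<tau> $ 4) has_real_derivative l t $ 2 * l t $ 3 / \<xi>\<^sup>2 - l t $ 5 * l t $ 6) (at t within {0..T})"
     "((\<lambda>\<tau>. l \<tau> $ 5) has_real_derivative l t $ 4 * l t $ 6 - l t $ 1 * l t $ 3 / \<xi>\<^sup>2) (at t within {0..T})" if "t \<in> {0..T}" for t T
    using sol[of T] that unfolding hamiltonian_solution_def by blast+
  note l6 = l6_eq_0[OF assms(1)]
  obtain \<epsilon> :: real where \<epsilon>: "\<bar>\<epsilon>\<bar> = 1" "\<And>t. 0 < t \<Longrightarrow> 0 < \<epsilon> * l t $ 3"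
    by (rule sign_before_cusp) (auto simp: cusp)
  show ?thesis
  proof (rule positive_concave_primitive_unbounded[where w = "\<lambda>t. \<epsilon> * l t $ 3" and k = "1 / \<xi>\<^sup>2"
        and w' = "\<lambda>t. \<epsilon> * (l t $ 1 * l t $ 5 - l t $ 2 * l t $ 4)"])
    fix t :: real assume t: "0 < t"
    then have at: "t \<in> {0..t+1}" "at t within {0..t+1} = at t"
      by (auto intro!: at_within_Icc_at)
    note d = ders[OF at(1), unfolded at(2)]
    show "((\<lambda>t. \<epsilon> * l t $ 3) has_real_derivative \<epsilon> * (l t $ 1 * l t $ 5 - l t $ 2 * l t $ 4)) (at t)"
      using d(3) by (auto intro!: derivative_eq_intros)
    \<comment> \<open>This is \<open>\<epsilon>\<close> times the second derivative of
      \<open>\<lambda>\<^sub>3\<close>; the remaining terms of that derivative carry the factor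
      \<open>\<lambda>\<^sub>6 = 0\<close>.\<close>
    define c where "c = - (\<epsilon> * l t $ 3) * ((l t $ 4)\<^sup>2 + (l t $ 5)\<^sup>2 + ((l t $ 1)\<^sup>2 + (l t $ 2)\<^sup>2) / \<xi>\<^sup>2)"
    have "((\<lambda>t. \<epsilon> * (l t $ 1 * l t $ 5 - l t $ 2 * l t $ 4)) has_real_derivative c) (at t)"
      using d(1,2,4,5) l6[of t] t
      by (auto intro!: derivative_eq_intros simp: c_def divide_inverse algebra_simps power2_eq_square)
    moreover have "c \<le> 0"
      unfolding c_def using \<epsilon>(2)[OF t] by (intro mult_nonpos_nonneg add_nonneg_nonneg divide_nonneg_nonneg) auto
    ultimately show "\<exists>c\<le>0. ((\<lambda>t. \<epsilon> * (l t $ 1 * l t $ 5 - l t $ 2 * l t $ 4)) has_real_derivative c) (at t)"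
      by blast
    show "0 < \<epsilon> * l t $ 3" by (rule \<epsilon>(2)[OF t])
    have "\<bar>l t $ 3\<bar> = \<epsilon> * l t $ 3"
      using \<epsilon>(1) \<epsilon>(2)[OF t] by (metis abs_mult abs_of_pos mult_1)
    then show "(arclength has_real_derivative 1 / \<xi>\<^sup>2 * (\<epsilon> * l t $ 3)) (at t)"
      using arclength_derivative[OF at(1)] unfolding at(2) by simp
  qed (use \<xi> in simp)
qed

text \<open>At a finite cusp time monotonicity makes the supremum \<open>s_max\<close> a maximum;
  without a cusp the length is unbounded. In both cases the intermediate value theorem gives
  \<open>T\<close>.\<close>

lemma arclength_attains:
  assumes "l0 $ 6 = 0" "0 < L" "ereal L \<le> s_max \<xi> l0"
  obtains T where "0 < T" "ereal T \<le> cusp_time \<xi> l0" "arclength T = L"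
proof -
  have "\<exists>b\<ge>0. ereal b \<le> cusp_time \<xi> l0 \<and> L \<le> arclength b"
  proof (cases "cusp_time \<xi> l0")
    case PInf
    then show ?thesis using arclength_unbounded[OF assms(1), of L] by (auto intro: less_imp_le)
  next
    case (real c)
    have "0 \<le> cusp_time \<xi> l0"
      unfolding cusp_time_eq by (rule Inf_greatest) auto
    then have c: "0 \<le> c" by (simp add: real)
    have "s_max \<xi> l0 \<le> ereal (arclength c)"
      unfolding s_max_def
    proof (rule Sup_least)
      fix s assume "s \<in> {ereal (spatial_length \<xi> l0 t) |t. 0 \<le> t \<and> ereal t \<le> cusp_time \<xi> l0}"
      then obtain t where "s = ereal (arclength t)" "0 \<le> t" "t \<le> c"
        using spatial_length_eq by (auto simp: real)
      then show "s \<le> ereal (arclength c)"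
        using arclength_strict_mono[of t c] by (cases "t = c") (auto simp: real)
    qed
    then have "L \<le> arclength c" using assms(3) order_trans by (metis ereal_less_eq(3))
    then show ?thesis using c by (auto simp: real)
  next
    case MInf
    have "0 \<le> cusp_time \<xi> l0"
      unfolding cusp_time_eq by (rule Inf_greatest) auto
    then show ?thesis by (simp add: MInf)
  qed
  then obtain b where b: "0 \<le> b" "ereal b \<le> cusp_time \<xi> l0" "L \<le> arclength b" by blast
  then obtain T where T: "0 \<le> T" "T \<le> b" "arclength T = L"
    using IVT'[of arclength 0 L b] arclength_0 assms(2) DERIV_continuous_on[OF arclength_derivative, of b] by auto
  moreover have "T \<noteq> 0" using T(3) assms(2) arclength_0 by auto
  ultimately show thesis
    using b(2) order_trans[of "ereal T" "ereal b"] by (intro that[of T]) auto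
qed

section \<open>Correspondence between forward arcs and points of the domain\<close>

lemma initial_tangent: "snd (\<gamma> 0) *v e_z = e_z"
  by (simp add: init se3_one_def)

lemma Exp_curve_arclength:
  assumes "0 \<le> T" "ereal T \<le> cusp_time \<xi> l0"
  shows "Exp_curve \<xi> l0 (arclength T) = (fst (\<gamma> T), snd (\<gamma> T) *v e_z)"
  using assms by (simp add: Exp_curve_def se3_act_def sr_time_arclength Exp_SE3_eq_geodesic)

lemma x_star_arclength:
  assumes "0 \<le> T" "ereal T \<le> cusp_time \<xi> l0"
  shows "x_star \<xi> l0 (arclength T) = fst (\<gamma> T)"
  using assms by (simp add: x_star_def sr_time_arclength Exp_SE3_eq_geodesic)

lemma arclength_pos: "0 < T \<Longrightarrow> ereal T \<le> cusp_time \<xi> l0 \<Longrightarrow> 0 < arclength T"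
  using arclength_strict_mono[of 0 T] arclength_0 by simp

text \<open>The norm of \<open>(\<lambda>\<^sub>1, \<lambda>\<^sub>2, \<lambda>\<^sub>3)\<close> is
  conserved and is positive once \<open>\<lambda>\<^sub>3\<close> is nonzero at some time.\<close>

lemma initial_translational_momentum_nonzero:
  assumes t: "0 \<le> t" and l3: "l t $ 3 \<noteq> 0"
  shows "(l0 $ 1, l0 $ 2, l0 $ 3) \<noteq> (0, 0, 0)"
proof
  assume "(l0 $ 1, l0 $ 2, l0 $ 3) = (0, 0, 0)"
  then have "fst (snd (lp_state \<gamma> l 0)) = 0"
    by (simp add: lp_state_def init vec_eq_iff forall_3 vector_3)
  moreover have "norm (fst (snd (lp_state \<gamma> l t))) = norm (fst (snd (lp_state \<gamma> l 0)))"
    by (rule lie_poisson_norm[where T = t and c = "\<lambda>_. 1" and \<xi> = \<xi>])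
      (use sol[of t] t in \<open>auto simp: hamiltonian_solution_iff\<close>)
  ultimately have "fst (snd (lp_state \<gamma> l t)) $ 3 = 0" by simp
  with l3 show False by (simp add: lp_state_def vector_3)
qed

lemma forward_arc_in_D0:
  assumes "l0 $ 6 = 0" and T: "0 < T" and pos: "\<And>t. 0 < t \<Longrightarrow> t < T \<Longrightarrow> 0 < l t $ 3"
  shows "(l0, arclength T) \<in> D0 \<xi>"
proof -
  have cusp: "ereal T \<le> cusp_time \<xi> l0"
    by (rule le_cusp_timeI) (use pos in force)
  have "hamiltonian \<xi> l0 = 1/2"
    using sol[of 0] init(2) unfolding hamiltonian_solution_def by auto
  moreover have "ereal (arclength T) \<le> s_max \<xi> l0"
    unfolding s_max_def using T cusp by (intro Sup_upper) (auto simp: spatial_length_eq intro!: exI[of _ T])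
  moreover have "(l0 $ 1, l0 $ 2, l0 $ 3) \<noteq> (0, 0, 0)"
    using initial_translational_momentum_nonzero[of "T/2"] pos[of "T/2"] T by simp
  moreover have "(x_star \<xi> l0 has_vector_derivative e_z) (at 0 within {0..arclength T})"
    using x_star_derivative[OF T cusp, of 1 0] pos T
    unfolding arclength_0 initial_tangent by simp
  ultimately show ?thesis
    using assms(1) arclength_pos[OF T cusp] by (simp add: D0_def)
qed

text \<open>The prescribed initial tangent fixes the sign: the computed tangent at 0 is
  \<open>\<epsilon> *\<^sub>R e_z\<close>, so \<open>\<epsilon> = 1\<close>.\<close>

lemma D0_forward_arc:
  assumes "(l0, L) \<in> D0 \<xi>"
  obtains T where "0 < T" "ereal T \<le> cusp_time \<xi> l0" "arclength T = L"
    "\<And>t. 0 < t \<Longrightarrow> t < T \<Longrightarrow> 0 < l t $ 3"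
proof -
  from assms have D: "0 < L" "l0 $ 6 = 0" "ereal L \<le> s_max \<xi> l0"
    and init_dir: "(x_star \<xi> l0 has_vector_derivative e_z) (at 0 within {0..L})"
    by (auto simp: D0_def)
  obtain T where T: "0 < T" "ereal T \<le> cusp_time \<xi> l0" "arclength T = L"
    using arclength_attains[OF D(2,1,3)] by blast
  obtain \<epsilon> :: real where \<epsilon>: "\<bar>\<epsilon>\<bar> = 1"
    "\<And>t. 0 < t \<Longrightarrow> ereal t < cusp_time \<xi> l0 \<Longrightarrow> 0 < \<epsilon> * l t $ 3"
    using sign_before_cusp by blast
  have pos: "0 < \<epsilon> * l t $ 3" if "0 < t" "t < T" for t
  proof (rule \<epsilon>(2))
    show "ereal t < cusp_time \<xi> l0"
      using less_le_trans[OF _ T(2), of "ereal t"] that by simp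
  qed (rule that)
  have "(x_star \<xi> l0 has_vector_derivative \<epsilon> *\<^sub>R e_z) (at 0 within {0..L})"
    using x_star_derivative[OF T(1,2) \<epsilon>(1) pos, of 0] T(1)
    unfolding T(3) arclength_0 initial_tangent by simp
  \<comment> \<open>One-sided derivatives at the end of a nondegenerate interval are unique, so the
    computed and the prescribed tangent can be compared.\<close>
  then have "vector_derivative (x_star \<xi> l0) (at 0 within {0..L}) = \<epsilon> *\<^sub>R e_z"
    by (rule vector_derivative_within_closed_interval[rotated 2]) (use D(1) in auto)
  moreover have "vector_derivative (x_star \<xi> l0) (at 0 within {0..L}) = e_z"
    using init_dir by (rule vector_derivative_within_closed_interval[rotated 2]) (use D(1) in auto)
  ultimately have "\<epsilon> *\<^sub>R e_z = e_z" by simp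
  then have "\<epsilon> = 1" by (simp add: vec_eq_iff forall_3 axis_def)
  with T pos show thesis by (intro that) auto
qed

end

section \<open>End conditions\<close>

text \<open>A middle term between the two sets, free of description operators and arclength. Only
  interior times are constrained, so the end point may be a cusp.\<close>

definition forward_ends :: "real \<Rightarrow> ((real^3) \<times> (real^3)) set" where
  "forward_ends \<xi> = {(fst (\<gamma> T), snd (\<gamma> T) *v e_z) | l0 \<gamma> l T. global_geodesic \<xi> l0 \<gamma> l \<and>
    l0 $ 6 = 0 \<and> 0 < T \<and> (\<forall>t. 0 < t \<longrightarrow> t < T \<longrightarrow> 0 < l t $ 3)}"

lemma global_geodesic_exists:
  assumes "0 < \<xi>" "hamiltonian \<xi> l0 = 1/2"
  obtains \<gamma> l where "global_geodesic \<xi> l0 \<gamma> l"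
  using geodesic_exists[OF assms(2)] assms(1) by (metis global_geodesic.intro)

text \<open>By uniqueness a geodesic on \<open>{0..T}\<close> is the restriction of a global one,
  and \<open>u\<^sup>3\<close> has the sign of \<open>\<lambda>\<^sub>3\<close>.\<close>

lemma cal_R_eq_forward_ends:
  assumes "0 < \<xi>"
  shows "cal_R \<xi> = forward_ends \<xi>"
proof (intro set_eqI iffI)
  fix z assume "z \<in> cal_R \<xi>"
  then obtain T \<gamma> l where z: "z = (fst (\<gamma> T), snd (\<gamma> T) *v e_z)" and T: "0 < T"
    and geo: "PMEC_geodesic \<xi> T \<gamma> l" and u3: "\<And>t. 0 < t \<Longrightarrow> t < T \<Longrightarrow> 0 < u3 \<gamma> t"
    and l6: "l 0 $ 6 = 0"
    unfolding cal_R_def frak_R_def by (fastforce simp: less_imp_le)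
  have geo': "hamiltonian_solution \<xi> {0..T} \<gamma> l" "\<gamma> 0 = se3_one"
    using geo by (auto simp: PMEC_geodesic_def)
  have "hamiltonian \<xi> (l 0) = 1/2"
    using geo'(1) T unfolding hamiltonian_solution_def by auto
  then obtain \<gamma>' l' where gg: "global_geodesic \<xi> (l 0) \<gamma>' l'"
    using global_geodesic_exists[OF assms] by blast
  then interpret global_geodesic \<xi> "l 0" \<gamma>' l' .
  have eq: "\<gamma> t = \<gamma>' t" "l t = l' t" if "t \<in> {0..T}" for t
    using hamiltonian_solution_unique[OF geo'(1) global_geodesic.sol[OF gg] _ _ that]
      geo'(2) global_geodesic.init[OF gg] by auto
  have "0 < l' t $ 3" if "0 < t" "t < T" for t
    using u3[OF that] u3_hamiltonian_solution[OF geo'(1) that] eq(2)[of t] that \<xi>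
    by (simp add: zero_less_divide_iff)
  then show "z \<in> forward_ends \<xi>"
    unfolding forward_ends_def z using gg T l6 eq(1)[of T] by fastforce
next
  fix z assume "z \<in> forward_ends \<xi>"
  then obtain l0 \<gamma> l T where z: "z = (fst (\<gamma> T), snd (\<gamma> T) *v e_z)" and gg: "global_geodesic \<xi> l0 \<gamma> l"
    and l6: "l0 $ 6 = 0" and T: "0 < T" and pos: "\<And>t. 0 < t \<Longrightarrow> t < T \<Longrightarrow> 0 < l t $ 3"
    unfolding forward_ends_def by blast
  interpret global_geodesic \<xi> l0 \<gamma> l by (rule gg)
  have "PMEC_geodesic \<xi> T \<gamma> l" using sol init by (simp add: PMEC_geodesic_def)
  moreover have "0 < u3 \<gamma> t" if "t \<in> {0<..<T}" for t
    using u3_hamiltonian_solution[OF sol, of t T] pos[of t] that \<xi> by simp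
  moreover have "l t $ 6 = 0" if "t \<in> {0..T}" for t
    using l6_eq_0[OF l6, of t] that by simp
  ultimately have "\<gamma> T \<in> frak_R \<xi>"
    unfolding frak_R_def using T by blast
  then show "z \<in> cal_R \<xi>" unfolding cal_R_def z by blast
qed

lemma D0_cases:
  assumes "0 < \<xi>" "(l0, L) \<in> D0 \<xi>"
  obtains \<gamma> l T where "global_geodesic \<xi> l0 \<gamma> l" "0 < T" "ereal T \<le> cusp_time \<xi> l0"
    "global_geodesic.arclength \<xi> l T = L" "\<And>t. 0 < t \<Longrightarrow> t < T \<Longrightarrow> 0 < l t $ 3" "l0 $ 6 = 0"
proof -
  have H: "hamiltonian \<xi> l0 = 1/2" "l0 $ 6 = 0" using assms(2) by (auto simp: D0_def)
  then obtain \<gamma> l where gg: "global_geodesic \<xi> l0 \<gamma> l"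
    using global_geodesic_exists[OF assms(1)] by blast
  show thesis
    by (rule global_geodesic.D0_forward_arc[OF gg assms(2)]) (rule that[OF gg _ _ _ _ H(2)])
qed

lemma Exp_curve_range_eq_forward_ends:
  assumes "0 < \<xi>"
  shows "{Exp_curve \<xi> l0 L | l0 L. (l0, L) \<in> D0 \<xi>} = forward_ends \<xi>"
proof (intro set_eqI iffI)
  fix z assume "z \<in> {Exp_curve \<xi> l0 L | l0 L. (l0, L) \<in> D0 \<xi>}"
  then obtain l0 L where D: "(l0, L) \<in> D0 \<xi>" and z: "z = Exp_curve \<xi> l0 L" by blast
  from assms D obtain \<gamma> l T where *: "global_geodesic \<xi> l0 \<gamma> l" "0 < T" "ereal T \<le> cusp_time \<xi> l0"
    "global_geodesic.arclength \<xi> l T = L" "\<And>t. 0 < t \<Longrightarrow> t < T \<Longrightarrow> 0 < l t $ 3" "l0 $ 6 = 0"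
    by (rule D0_cases) (rule that)
  have "z = (fst (\<gamma> T), snd (\<gamma> T) *v e_z)"
    using global_geodesic.Exp_curve_arclength[OF *(1), of T] * z by simp
  with * show "z \<in> forward_ends \<xi>" unfolding forward_ends_def by blast
next
  fix z assume "z \<in> forward_ends \<xi>"
  then obtain l0 \<gamma> l T where z: "z = (fst (\<gamma> T), snd (\<gamma> T) *v e_z)" and gg: "global_geodesic \<xi> l0 \<gamma> l"
    and l6: "l0 $ 6 = 0" and T: "0 < T" and pos: "\<And>t. 0 < t \<Longrightarrow> t < T \<Longrightarrow> 0 < l t $ 3"
    unfolding forward_ends_def by blast
  interpret global_geodesic \<xi> l0 \<gamma> l by (rule gg)
  have "ereal T \<le> cusp_time \<xi> l0" by (rule le_cusp_timeI) (use pos in force)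
  then have "z = Exp_curve \<xi> l0 (arclength T)"
    using Exp_curve_arclength[of T] T z by simp
  then show "z \<in> {Exp_curve \<xi> l0 L | l0 L. (l0, L) \<in> D0 \<xi>}"
    using forward_arc_in_D0[OF l6 T pos] by blast
qed

text \<open>The second component of the exponential map is the actual tangent at the end point:
  one-sided differentiation in spatial arclength yields \<open>R e_z\<close> there, also at a
  cusp.\<close>

lemma Exp_curve_eq_end_condition:
  assumes \<xi>: "0 < \<xi>" and D: "(l0, L) \<in> D0 \<xi>" and x: "\<And>s. s \<in> {0..L} \<Longrightarrow> x s = x_star \<xi> l0 s"
  shows "(x L, vector_derivative x (at L within {0..L})) = Exp_curve \<xi> l0 L"
proof -
  from \<xi> D obtain \<gamma> l T where *: "global_geodesic \<xi> l0 \<gamma> l" "0 < T" "ereal T \<le> cusp_time \<xi> l0"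
    "global_geodesic.arclength \<xi> l T = L" "\<And>t. 0 < t \<Longrightarrow> t < T \<Longrightarrow> 0 < l t $ 3" "l0 $ 6 = 0"
    by (rule D0_cases) (rule that)
  interpret global_geodesic \<xi> l0 \<gamma> l by (rule *(1))
  have L: "L = arclength T" using *(4) by simp
  have pos: "0 < L" using D by (simp add: D0_def)
  have "(x_star \<xi> l0 has_vector_derivative snd (\<gamma> T) *v e_z) (at L within {0..L})"
    using x_star_derivative[OF *(2,3), of 1 T] *(2,5) by (simp add: L)
  then have "(x has_vector_derivative snd (\<gamma> T) *v e_z) (at L within {0..L})"
    by (rule has_vector_derivative_transform[rotated 2]) (use pos x in auto)
  then have "vector_derivative x (at L within {0..L}) = snd (\<gamma> T) *v e_z"
    by (rule vector_derivative_within_closed_interval[rotated 2]) (use pos in auto)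
  moreover have "x L = fst (\<gamma> T)"
    using x[of L] pos x_star_arclength[of T] *(2,3) by (simp add: L)
  moreover have "Exp_curve \<xi> l0 L = (fst (\<gamma> T), snd (\<gamma> T) *v e_z)"
    using Exp_curve_arclength[of T] *(2,3) by (simp add: L)
  ultimately show ?thesis by simp
qed

lemma forward_ends_subset: "forward_ends \<xi> \<subseteq> R3S2"
proof
  fix z assume "z \<in> forward_ends \<xi>"
  then obtain l0 \<gamma> l T where z: "z = (fst (\<gamma> T), snd (\<gamma> T) *v e_z)" and gg: "global_geodesic \<xi> l0 \<gamma> l"
    and T: "0 < T"
    unfolding forward_ends_def by blast
  then show "z \<in> R3S2"
    using global_geodesic.norm_tangent[OF gg, of T] by (simp add: R3S2_def)
qed

theorem corollary1:
  fixes \<xi> :: real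
  assumes "\<xi> > 0"
  shows "cal_R \<xi> = {Exp_curve \<xi> l0 L | l0 L. (l0, L) \<in> D0 \<xi>}
    \<and> cal_R \<xi> \<subseteq> R3S2
    \<and> cal_R \<xi> = {(x L, vector_derivative x (at L within {0..L})) | x L. Pcurve_geodesic \<xi> L x}"
proof -
  have "{(x L, vector_derivative x (at L within {0..L})) | x L. Pcurve_geodesic \<xi> L x}
      = {Exp_curve \<xi> l0 L | l0 L. (l0, L) \<in> D0 \<xi>}" (is "?P = ?E")
  proof (intro set_eqI iffI)
    fix z assume "z \<in> ?P"
    then show "z \<in> ?E"
      unfolding Pcurve_geodesic_def using Exp_curve_eq_end_condition[OF assms] by fastforce
  next
    fix z assume "z \<in> ?E"
    then obtain l0 L where D: "(l0, L) \<in> D0 \<xi>" and z: "z = Exp_curve \<xi> l0 L" by blast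
    have "Pcurve_geodesic \<xi> L (x_star \<xi> l0)"
      using D by (auto simp: Pcurve_geodesic_def)
    then show "z \<in> ?P"
      unfolding z using Exp_curve_eq_end_condition[OF assms D, of "x_star \<xi> l0"] by force
  qed
  then show ?thesis
    using cal_R_eq_forward_ends[OF assms] Exp_curve_range_eq_forward_ends[OF assms]
      forward_ends_subset by simp
qed

end
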